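(* Let $(M,\eta,\phi_1,\phi_2,\phi_3)$ be an almost bi-paracontact manifold of dimension $2n+1$. Then 1. $\phi_1(\mathcal D_2^+)=\mathcal D_2^-$, $\phi_1(\mathcal D_2^-)=\mathcal D_2^+$; 2. $\phi_2(\mathcal D_1^+)=\mathcal D_1^-$, $\phi_2(\mathcal D_1^-)=\mathcal D_1^+$; 3. $\phi_3(\mathcal D_\alpha^+)=\mathcal D_\alpha^-$, $\phi_3(\mathcal D_\alpha^-)=\mathcal D_\alpha^+$ for each $\alpha\in\{1,2\}$; 4. $\phi_1:\mathcal D_2^+\to\mathcal D_2^-$ and $\phi_2:\mathcal D_1^+\to\mathcal D_1^-$ are isomorphisms; 5. the tangent bundle of $M$ splits up as the direct sum $TM=\mathcal D_\alpha^+\oplus\mathcal D_\alpha^-\oplus\mathbb R\xi=\mathcal D_\alpha^{\pm}\oplus\mathcal D_\beta^{\pm}\oplus\mathbb R\xi$ for all $\alpha,\beta\in\{1,2\}$, $\alpha\neq\beta$ (for every choice of the two signs); 6. $\dim(\mathcal D_1^+)=\dim(\mathcal D_1^-)=\dim(\mathcal D_2^+)=\dim(\mathcal D_2^-)=n$. In particular, $\phi_1$ and $\phi_2$ are almost paracontact structures.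
   Context: Everything is smooth. A contact manifold $(M,\eta)$ is a $(2n+1)$-dimensional manifold with a $1$-form $\eta$ such that $\eta\wedge(d\eta)^n\neq 0$ everywhere; its Reeb vector field $\xi$ is determined by $\eta(\xi)=1$, $d\eta(\xi,\cdot)=0$; $\mathcal D=\ker\eta$. An almost bi-paracontact structure on $(M,\eta)$ is a triplet $(\phi_1,\phi_2,\phi_3)$ of $(1,1)$-tensor fields with $\phi_1\phi_2=-\phi_2\phi_1$, $\phi_1^2=\phi_2^2=I-\eta\otimes\xi$, $\phi_3=\phi_1\phi_2$, $\phi_3^2=-I+\eta\otimes\xi$. For $\alpha\in\{1,2\}$, $\mathcal D_\alpha^\pm$ is the eigendistribution of $\phi_\alpha$ for the eigenvalue $\pm1$. $\dim$ of a distribution means its rank. An almost paracontact structure on a $(2n+1)$-dimensional manifold is $(\tilde\phi,\xi,\eta)$ with $\eta(\xi)=1$, $\tilde\phi^2=I-\eta\otimes\xi$, and such that $\tilde\phi$ induces an almost paracomplex structure on each fibre of $\mathcal D=\ker\eta$, i.e. the $\pm1$-eigendistributions of $\tilde\phi|_{\mathcal D}$ both have rank $n$. *)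

theory Defs
  imports
    "HOL-Analysis.Analysis"
    "HOL-Library.Function_Algebras"
    "HOL-Combinatorics.Permutations"
begin

section \<open>Smooth maps between normed vector spaces\<close>

text \<open>
  Derivatives are taken at interior points (\<open>at x\<close>), so \<open>Ck_on\<close> and \<open>smooth_on\<close> are meant for
  open sets \<open>S\<close>. On a finite-dimensional domain, continuity of all iterated directional
  derivatives, each of them again differentiable, is the usual notion of a smooth map.
\<close>

primrec Ck_on ::
  "nat \<Rightarrow> 'e::real_normed_vector set \<Rightarrow> ('e \<Rightarrow> 'f::real_normed_vector) \<Rightarrow> bool" where
  "Ck_on 0 S f \<longleftrightarrow> continuous_on S f"
| "Ck_on (Suc k) S f \<longleftrightarrow>
     (\<forall>x\<in>S. f differentiable (at x)) \<and>
     (\<forall>v. Ck_on k S (\<lambda>x. frechet_derivative f (at x) v))"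

definition smooth_on ::
  "'e::real_normed_vector set \<Rightarrow> ('e \<Rightarrow> 'f::real_normed_vector) \<Rightarrow> bool" where
  "smooth_on S f \<longleftrightarrow> (\<forall>k. Ck_on k S f)"


section \<open>Smooth manifolds\<close>

text \<open>
  A chart is a pair \<open>(U, f)\<close> of a domain and a coordinate map; the values of \<open>f\<close> outside \<open>U\<close>
  are irrelevant. A manifold is a topology \<open>M\<close> with an atlas \<open>A\<close> (not necessarily maximal)
  of charts into a Euclidean space \<open>'e\<close>; its dimension is \<open>DIM('e)\<close>.
\<close>

type_synonym ('a, 'e) chart = "'a set \<times> ('a \<Rightarrow> 'e)"

definition chart_inv :: "('a, 'e) chart \<Rightarrow> 'e \<Rightarrow> 'a" where
  "chart_inv \<kappa> = inv_into (fst \<kappa>) (snd \<kappa>)"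

definition transition :: "('a, 'e) chart \<Rightarrow> ('a, 'e) chart \<Rightarrow> 'e \<Rightarrow> 'e" where
  "transition \<kappa> \<kappa>' = snd \<kappa>' \<circ> chart_inv \<kappa>"

definition smooth_manifold :: "'a topology \<Rightarrow> ('a, 'e::euclidean_space) chart set \<Rightarrow> bool" where
  "smooth_manifold M A \<longleftrightarrow>
     Hausdorff_space M \<and>
     (\<exists>\<B>. countable \<B> \<and> (\<forall>B\<in>\<B>. openin M B) \<and>
          (\<forall>U x. openin M U \<and> x \<in> U \<longrightarrow> (\<exists>B\<in>\<B>. x \<in> B \<and> B \<subseteq> U))) \<and>
     (\<forall>(U, f)\<in>A. openin M U \<and> open (f ` U) \<and>
          homeomorphic_map (subtopology M U) (top_of_set (f ` U)) f) \<and>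
     (\<Union>\<kappa>\<in>A. fst \<kappa>) = topspace M \<and>
     (\<forall>\<kappa>\<in>A. \<forall>\<kappa>'\<in>A. smooth_on (snd \<kappa> ` (fst \<kappa> \<inter> fst \<kappa>')) (transition \<kappa> \<kappa>'))"


section \<open>Tangent vectors\<close>

instantiation "fun" :: (type, scaleR) scaleR
begin

definition scaleR_fun_def: "c *\<^sub>R f = (\<lambda>x. c *\<^sub>R f x)"

instance ..

end

lemma scaleR_fun_apply [simp]: "(c *\<^sub>R f) x = c *\<^sub>R f x"
  by (simp add: scaleR_fun_def)

instance "fun" :: (type, real_vector) real_vector
  by standard (simp_all add: fun_eq_iff algebra_simps)

text \<open>
  A tangent vector at \<open>p\<close> is the family of its coordinate vectors in all charts around \<open>p\<close>,
  subject to the transformation law; it is extended by \<open>0\<close> to the other charts, so that tangent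
  vectors at \<open>p\<close> form a linear subspace of a function space.
\<close>

type_synonym ('a, 'e) tvec = "('a, 'e) chart \<Rightarrow> 'e"

definition tangent_space ::
  "('a, 'e::euclidean_space) chart set \<Rightarrow> 'a \<Rightarrow> ('a, 'e) tvec set" where
  "tangent_space A p =
     {v. (\<forall>\<kappa>\<in>A. \<forall>\<kappa>'\<in>A. p \<in> fst \<kappa> \<and> p \<in> fst \<kappa>' \<longrightarrow>
            v \<kappa>' = frechet_derivative (transition \<kappa> \<kappa>') (at (snd \<kappa> p)) (v \<kappa>)) \<and>
         (\<forall>\<kappa>. \<not> (\<kappa> \<in> A \<and> p \<in> fst \<kappa>) \<longrightarrow> v \<kappa> = 0)}"

text \<open>The tangent vector at \<open>p\<close> with coordinate vector \<open>e\<close> in the chart \<open>\<kappa>\<close>.\<close>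

definition chart_vec ::
  "('a, 'e::euclidean_space) chart set \<Rightarrow> ('a, 'e) chart \<Rightarrow> 'a \<Rightarrow> 'e \<Rightarrow> ('a, 'e) tvec" where
  "chart_vec A \<kappa> p e =
     (\<lambda>\<kappa>'. if \<kappa>' \<in> A \<and> p \<in> fst \<kappa>'
           then frechet_derivative (transition \<kappa> \<kappa>') (at (snd \<kappa> p)) e else 0)"


section \<open>Tensor fields\<close>

definition linear_on :: "'v::real_vector set \<Rightarrow> ('v \<Rightarrow> 'w::real_vector) \<Rightarrow> bool" where
  "linear_on V f \<longleftrightarrow>
     (\<forall>u\<in>V. \<forall>v\<in>V. f (u + v) = f u + f v) \<and> (\<forall>c. \<forall>v\<in>V. f (c *\<^sub>R v) = c *\<^sub>R f v)"

text \<open>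
  Fields assign to each point \<open>p\<close> a tangent vector, a linear form on the tangent space at \<open>p\<close>,
  or an endomorphism of it. Smoothness is smoothness of the components in every chart.
\<close>

definition smooth_vector_field_on ::
  "('a, 'e::euclidean_space) chart set \<Rightarrow> 'a set \<Rightarrow> ('a \<Rightarrow> ('a, 'e) tvec) \<Rightarrow> bool" where
  "smooth_vector_field_on A V X \<longleftrightarrow>
     (\<forall>p\<in>V. X p \<in> tangent_space A p) \<and>
     (\<forall>\<kappa>\<in>A. smooth_on (snd \<kappa> ` (fst \<kappa> \<inter> V)) (\<lambda>x. X (chart_inv \<kappa> x) \<kappa>))"

definition smooth_one_form ::
  "'a topology \<Rightarrow> ('a, 'e::euclidean_space) chart set \<Rightarrow>
   ('a \<Rightarrow> ('a, 'e) tvec \<Rightarrow> real) \<Rightarrow> bool" where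
  "smooth_one_form M A \<omega> \<longleftrightarrow>
     (\<forall>p\<in>topspace M. linear_on (tangent_space A p) (\<omega> p)) \<and>
     (\<forall>\<kappa>\<in>A. \<forall>e. smooth_on (snd \<kappa> ` fst \<kappa>)
        (\<lambda>x. \<omega> (chart_inv \<kappa> x) (chart_vec A \<kappa> (chart_inv \<kappa> x) e)))"

definition smooth_tensor11 ::
  "'a topology \<Rightarrow> ('a, 'e::euclidean_space) chart set \<Rightarrow>
   ('a \<Rightarrow> ('a, 'e) tvec \<Rightarrow> ('a, 'e) tvec) \<Rightarrow> bool" where
  "smooth_tensor11 M A \<phi> \<longleftrightarrow>
     (\<forall>p\<in>topspace M. linear_on (tangent_space A p) (\<phi> p) \<and>
        \<phi> p ` tangent_space A p \<subseteq> tangent_space A p) \<and>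
     (\<forall>\<kappa>\<in>A. \<forall>e. smooth_on (snd \<kappa> ` fst \<kappa>)
        (\<lambda>x. \<phi> (chart_inv \<kappa> x) (chart_vec A \<kappa> (chart_inv \<kappa> x) e) \<kappa>))"


section \<open>Exterior algebra and contact forms\<close>

text \<open>
  A \<open>k\<close>-form on a vector space is represented as a function of a sequence of vectors, of which
  only the first \<open>k\<close> entries matter.
\<close>

definition wedge ::
  "nat \<Rightarrow> nat \<Rightarrow> ((nat \<Rightarrow> 'v) \<Rightarrow> real) \<Rightarrow> ((nat \<Rightarrow> 'v) \<Rightarrow> real) \<Rightarrow> (nat \<Rightarrow> 'v) \<Rightarrow> real" where
  "wedge k l \<omega> \<tau> v =
     (\<Sum>\<sigma> | \<sigma> permutes {..<k + l}.
        of_int (sign \<sigma>) * \<omega> (\<lambda>i. v (\<sigma> i)) * \<tau> (\<lambda>i. v (\<sigma> (k + i)))) / (fact k * fact l)"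

primrec wedge_power ::
  "nat \<Rightarrow> ((nat \<Rightarrow> 'v) \<Rightarrow> real) \<Rightarrow> nat \<Rightarrow> (nat \<Rightarrow> 'v) \<Rightarrow> real" where
  "wedge_power k \<omega> 0 = (\<lambda>_. 1)"
| "wedge_power k \<omega> (Suc m) = wedge k (m * k) \<omega> (wedge_power k \<omega> m)"

text \<open>
  With \<open>\<omega>\<^sub>e x = \<omega>\<^sub>x(e)\<close> for a constant coordinate vector \<open>e\<close>, the exterior derivative of a
  one-form is \<open>d\<omega>(u, v) = \<partial>\<^sub>u \<omega>\<^sub>v - \<partial>\<^sub>v \<omega>\<^sub>u\<close> in any chart; the value does not depend on the
  chart, so an arbitrary chart around \<open>p\<close> is chosen. (Conventions with a factor \<open>1/2\<close> give the
  same contact forms and Reeb fields.)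
\<close>

definition ext_deriv_chart ::
  "('a, 'e::euclidean_space) chart set \<Rightarrow> ('a, 'e) chart \<Rightarrow> ('a \<Rightarrow> ('a, 'e) tvec \<Rightarrow> real) \<Rightarrow>
   'a \<Rightarrow> ('a, 'e) tvec \<Rightarrow> ('a, 'e) tvec \<Rightarrow> real" where
  "ext_deriv_chart A \<kappa> \<omega> p u v =
     (let comp = (\<lambda>e x. \<omega> (chart_inv \<kappa> x) (chart_vec A \<kappa> (chart_inv \<kappa> x) e))
      in frechet_derivative (comp (v \<kappa>)) (at (snd \<kappa> p)) (u \<kappa>)
       - frechet_derivative (comp (u \<kappa>)) (at (snd \<kappa> p)) (v \<kappa>))"

definition ext_deriv ::
  "('a, 'e::euclidean_space) chart set \<Rightarrow> ('a \<Rightarrow> ('a, 'e) tvec \<Rightarrow> real) \<Rightarrow>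
   'a \<Rightarrow> ('a, 'e) tvec \<Rightarrow> ('a, 'e) tvec \<Rightarrow> real" where
  "ext_deriv A \<omega> p = ext_deriv_chart A (SOME \<kappa>. \<kappa> \<in> A \<and> p \<in> fst \<kappa>) \<omega> p"

definition contact_manifold ::
  "nat \<Rightarrow> 'a topology \<Rightarrow> ('a, 'e::euclidean_space) chart set \<Rightarrow>
   ('a \<Rightarrow> ('a, 'e) tvec \<Rightarrow> real) \<Rightarrow> bool" where
  "contact_manifold n M A \<eta> \<longleftrightarrow>
     smooth_manifold M A \<and> DIM('e) = 2 * n + 1 \<and> smooth_one_form M A \<eta> \<and>
     (\<forall>p\<in>topspace M. \<exists>v. (\<forall>i < 2 * n + 1. v i \<in> tangent_space A p) \<and>
        wedge 1 (2 * n) (\<lambda>w. \<eta> p (w 0))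
          (wedge_power 2 (\<lambda>w. ext_deriv A \<eta> p (w 0) (w 1)) n) v \<noteq> 0)"

definition is_reeb_field ::
  "'a topology \<Rightarrow> ('a, 'e::euclidean_space) chart set \<Rightarrow> ('a \<Rightarrow> ('a, 'e) tvec \<Rightarrow> real) \<Rightarrow>
   ('a \<Rightarrow> ('a, 'e) tvec) \<Rightarrow> bool" where
  "is_reeb_field M A \<eta> \<xi> \<longleftrightarrow>
     smooth_vector_field_on A (topspace M) \<xi> \<and>
     (\<forall>p\<in>topspace M. \<eta> p (\<xi> p) = 1 \<and> (\<forall>v\<in>tangent_space A p. ext_deriv A \<eta> p (\<xi> p) v = 0))"


section \<open>Distributions\<close>

definition distribution_of_rank ::
  "'a topology \<Rightarrow> ('a, 'e::euclidean_space) chart set \<Rightarrow> nat \<Rightarrow>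
   ('a \<Rightarrow> ('a, 'e) tvec set) \<Rightarrow> bool" where
  "distribution_of_rank M A k D \<longleftrightarrow>
     (\<forall>p\<in>topspace M.
        D p \<subseteq> tangent_space A p \<and> subspace (D p) \<and> dim (D p) = k \<and>
        (\<exists>V X. openin M V \<and> p \<in> V \<and>
           (\<forall>i<k. smooth_vector_field_on A V (X i)) \<and>
           (\<forall>q\<in>V. D q = span ((\<lambda>i. X i q) ` {..<k}))))"

definition eigendistribution ::
  "('a, 'e::euclidean_space) chart set \<Rightarrow> ('a \<Rightarrow> ('a, 'e) tvec \<Rightarrow> ('a, 'e) tvec) \<Rightarrow>
   real \<Rightarrow> 'a \<Rightarrow> ('a, 'e) tvec set" where
  "eigendistribution A \<phi> c p = {v \<in> tangent_space A p. \<phi> p v = c *\<^sub>R v}"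

definition contact_distribution ::
  "('a, 'e::euclidean_space) chart set \<Rightarrow> ('a \<Rightarrow> ('a, 'e) tvec \<Rightarrow> real) \<Rightarrow>
   'a \<Rightarrow> ('a, 'e) tvec set" where
  "contact_distribution A \<eta> p = {v \<in> tangent_space A p. \<eta> p v = 0}"

text \<open>
  The smoothness clause says that \<open>\<phi>\<close> and its fibrewise inverse map smooth local sections to
  smooth local sections.
\<close>

definition distribution_isomorphism ::
  "'a topology \<Rightarrow> ('a, 'e::euclidean_space) chart set \<Rightarrow>
   ('a \<Rightarrow> ('a, 'e) tvec set) \<Rightarrow> ('a \<Rightarrow> ('a, 'e) tvec set) \<Rightarrow>
   ('a \<Rightarrow> ('a, 'e) tvec \<Rightarrow> ('a, 'e) tvec) \<Rightarrow> bool" where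
  "distribution_isomorphism M A D E \<phi> \<longleftrightarrow>
     (\<forall>p\<in>topspace M. linear_on (D p) (\<phi> p) \<and> bij_betw (\<phi> p) (D p) (E p)) \<and>
     (\<forall>V X. openin M V \<and> (\<forall>p\<in>V. X p \<in> D p) \<longrightarrow>
        (smooth_vector_field_on A V X \<longleftrightarrow> smooth_vector_field_on A V (\<lambda>p. \<phi> p (X p))))"

definition direct_sum3 ::
  "'v::real_vector set \<Rightarrow> 'v set \<Rightarrow> 'v set \<Rightarrow> 'v set \<Rightarrow> bool" where
  "direct_sum3 T U V W \<longleftrightarrow>
     subspace U \<and> subspace V \<and> subspace W \<and> U \<subseteq> T \<and> V \<subseteq> T \<and> W \<subseteq> T \<and>
     (\<forall>t\<in>T. \<exists>!(u, v, w). u \<in> U \<and> v \<in> V \<and> w \<in> W \<and> t = u + v + w)"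


section \<open>Almost paracontact and almost bi-paracontact structures\<close>

definition almost_paracontact ::
  "nat \<Rightarrow> 'a topology \<Rightarrow> ('a, 'e::euclidean_space) chart set \<Rightarrow>
   ('a \<Rightarrow> ('a, 'e) tvec \<Rightarrow> ('a, 'e) tvec) \<Rightarrow> ('a \<Rightarrow> ('a, 'e) tvec) \<Rightarrow>
   ('a \<Rightarrow> ('a, 'e) tvec \<Rightarrow> real) \<Rightarrow> bool" where
  "almost_paracontact n M A \<phi> \<xi> \<eta> \<longleftrightarrow>
     smooth_manifold M A \<and> DIM('e) = 2 * n + 1 \<and>
     smooth_tensor11 M A \<phi> \<and> smooth_vector_field_on A (topspace M) \<xi> \<and> smooth_one_form M A \<eta> \<and>
     (\<forall>p\<in>topspace M. \<eta> p (\<xi> p) = 1 \<and>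
        (\<forall>v\<in>tangent_space A p. \<phi> p (\<phi> p v) = v - \<eta> p v *\<^sub>R \<xi> p) \<and>
        \<phi> p ` contact_distribution A \<eta> p \<subseteq> contact_distribution A \<eta> p) \<and>
     (\<forall>c\<in>{1, -1}. distribution_of_rank M A n
        (\<lambda>p. eigendistribution A \<phi> c p \<inter> contact_distribution A \<eta> p))"

text \<open>The triplet of tensor fields is \<open>\<phi> 1, \<phi> 2, \<phi> 3\<close>; other indices are irrelevant.\<close>

definition almost_bi_paracontact ::
  "nat \<Rightarrow> 'a topology \<Rightarrow> ('a, 'e::euclidean_space) chart set \<Rightarrow>
   ('a \<Rightarrow> ('a, 'e) tvec \<Rightarrow> real) \<Rightarrow> ('a \<Rightarrow> ('a, 'e) tvec) \<Rightarrow>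
   (nat \<Rightarrow> 'a \<Rightarrow> ('a, 'e) tvec \<Rightarrow> ('a, 'e) tvec) \<Rightarrow> bool" where
  "almost_bi_paracontact n M A \<eta> \<xi> \<phi> \<longleftrightarrow>
     contact_manifold n M A \<eta> \<and> is_reeb_field M A \<eta> \<xi> \<and>
     (\<forall>i\<in>{1, 2, 3}. smooth_tensor11 M A (\<phi> i)) \<and>
     (\<forall>p\<in>topspace M. \<forall>v\<in>tangent_space A p.
        \<phi> 1 p (\<phi> 2 p v) = - \<phi> 2 p (\<phi> 1 p v) \<and>
        \<phi> 1 p (\<phi> 1 p v) = v - \<eta> p v *\<^sub>R \<xi> p \<and>
        \<phi> 2 p (\<phi> 2 p v) = v - \<eta> p v *\<^sub>R \<xi> p \<and>
        \<phi> 3 p v = \<phi> 1 p (\<phi> 2 p v) \<and>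
        \<phi> 3 p (\<phi> 3 p v) = - v + \<eta> p v *\<^sub>R \<xi> p)"

end

theory Submission
  imports Defs
begin

text \<open>
  The core of the argument is linear algebra in one tangent space \<open>T\<close>. Write \<open>f\<close>, \<open>g\<close> for \<open>\<phi>\<^sub>1\<close>,
  \<open>\<phi>\<^sub>2\<close> at the point. The relation \<open>f\<^sup>2 = I - \<eta> \<otimes> \<xi>\<close> together with \<open>\<eta>(\<xi>) = 1\<close> forces \<open>f \<xi> = 0\<close>
  and \<open>\<eta> \<circ> f = 0\<close>; hence all eigenvectors for \<open>\<plusminus>1\<close> lie in \<open>ker \<eta>\<close>, where \<open>f\<close> is an involution,
  and \<open>T\<close> is the direct sum of both eigenspaces and the line of \<open>\<xi>\<close>. As \<open>f\<close> and \<open>g\<close> anticommute,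
  \<open>f\<close> interchanges the two eigenspaces of \<open>g\<close> and vice versa, while each map preserves its own
  eigenspaces; this gives the images under \<open>\<phi>\<^sub>3 = f g\<close> too. An eigenspace of \<open>f\<close> meets one of
  \<open>g\<close> only in \<open>0\<close>, since on a common eigenvector \<open>f g = g f\<close>, and an explicit formula shows that
  any such two span \<open>ker \<eta>\<close> (\<open>direct_sum3_mixed_eigenspaces\<close>).

  The ranks follow from the direct sums alone: by the mixed ones, each eigenspace of \<open>f\<close> has
  the dimension \<open>2n - dim E\<close> for a fixed eigenspace \<open>E\<close> of \<open>g\<close>, so both have the same dimension,
  and these two dimensions add up to \<open>2n\<close>. Dimensions are counted in a chart, because taking the
  component in a chart identifies \<open>T\<close> with the model space (\<open>dim_direct_sum3_tangent\<close>).

  The remaining assertions concern smoothness. Expanding a smooth field in the coordinate fields of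
  a chart shows that smooth tensor fields map smooth fields to smooth fields
  (\<open>smooth_tensor11_apply\<close>). So the fibrewise isomorphisms given by \<open>\<phi>\<^sub>1\<close> and \<open>\<phi>\<^sub>2\<close>, which are
  involutions of \<open>ker \<eta>\<close>, preserve smoothness of sections in both directions. It also makes
  \<open>(\<phi>\<^sub>\<alpha>\<^sup>2 \<plusminus> \<phi>\<^sub>\<alpha>) / 2\<close> a smooth projection onto an eigendistribution, and the image of a smooth
  projection of constant rank has local smooth frames: fields with constant components in a chart
  that form a basis of the fibre at one point still have independent projections nearby
  (\<open>distribution_of_rank_projection\<close>).
\<close>

section \<open>Calculus of smooth maps\<close>

lemma Ck_on_subset: "Ck_on k S f \<Longrightarrow> T \<subseteq> S \<Longrightarrow> Ck_on k T f"
  by (induction k arbitrary: f) (auto intro: continuous_on_subset)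

lemma Ck_on_cong:
  assumes "open S" "\<And>x. x \<in> S \<Longrightarrow> f x = g x"
  shows "Ck_on k S f \<longleftrightarrow> Ck_on k S g"
  using assms(2)
proof (induction k arbitrary: f g)
  case 0
  then show ?case by (simp cong: continuous_on_cong)
next
  case (Suc k)
  have has: "(f has_derivative D) (at x) \<longleftrightarrow> (g has_derivative D) (at x)" if "x \<in> S" for x D
    using has_derivative_transform_within_open[OF _ \<open>open S\<close> that, of f D UNIV g]
      has_derivative_transform_within_open[OF _ \<open>open S\<close> that, of g D UNIV f] Suc.prems
    by auto
  then have "f differentiable (at x) \<longleftrightarrow> g differentiable (at x)" if "x \<in> S" for x
    using that unfolding differentiable_def by blast
  moreover have "frechet_derivative f (at x) = frechet_derivative g (at x)" if "x \<in> S" for x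
    using has[OF that] unfolding frechet_derivative_def by simp
  then have "Ck_on k S (\<lambda>x. frechet_derivative f (at x) v) \<longleftrightarrow>
      Ck_on k S (\<lambda>x. frechet_derivative g (at x) v)" for v
    by (intro Suc.IH) simp
  ultimately show ?case by simp
qed

text \<open>
  The derivatives inside \<open>Ck_on\<close> are values of a choice operator; with this lemma the closure
  properties below can work with any derivative that is known explicitly.
\<close>

lemma Ck_on_Suc_iff:
  assumes "open S" "\<And>x. x \<in> S \<Longrightarrow> (f has_derivative f' x) (at x)"
  shows "Ck_on (Suc k) S f \<longleftrightarrow> (\<forall>v. Ck_on k S (\<lambda>x. f' x v))"
proof -
  have "Ck_on k S (\<lambda>x. frechet_derivative f (at x) v) \<longleftrightarrow> Ck_on k S (\<lambda>x. f' x v)" for v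
    by (rule Ck_on_cong[OF assms(1)]) (metis assms(2) frechet_derivative_at)
  with assms(2) show ?thesis by (auto simp: differentiable_def)
qed

lemma Ck_on_SucD: "Ck_on (Suc k) S f \<Longrightarrow> Ck_on k S f"
proof (induction k arbitrary: f)
  case 0
  then show ?case
    by (auto intro!: continuous_at_imp_continuous_on differentiable_imp_continuous_within)
next
  case (Suc k)
  have "Ck_on k S (\<lambda>x. frechet_derivative f (at x) v)" for v
    using Suc.IH Suc.prems by (metis Ck_on.simps(2))
  with Suc.prems show ?case by simp
qed

lemma Ck_on_Suc_has_derivative:
  "Ck_on (Suc k) S f \<Longrightarrow> x \<in> S \<Longrightarrow> (f has_derivative frechet_derivative f (at x)) (at x)"
  by (simp add: frechet_derivative_works)

lemma Ck_on_const: "open S \<Longrightarrow> Ck_on k S (\<lambda>x. c)"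
proof (induction k arbitrary: c)
  case (Suc k)
  then show ?case
    by (subst Ck_on_Suc_iff[where f' = "\<lambda>x v. 0"]) auto
qed simp

lemma Ck_on_add:
  assumes "open S"
  shows "Ck_on k S f \<Longrightarrow> Ck_on k S g \<Longrightarrow> Ck_on k S (\<lambda>x. f x + g x)"
proof (induction k arbitrary: f g)
  case 0
  then show ?case by (simp add: continuous_on_add)
next
  case (Suc k)
  have "Ck_on k S (\<lambda>x. frechet_derivative f (at x) v + frechet_derivative g (at x) v)" for v
    using Suc by simp
  then show ?case
    by (subst Ck_on_Suc_iff[OF assms, OF has_derivative_add])
      (auto intro: Ck_on_Suc_has_derivative[OF Suc.prems(1)]
        Ck_on_Suc_has_derivative[OF Suc.prems(2)])
qed

lemma Ck_on_sum:
  assumes "open S" "\<And>i. i \<in> I \<Longrightarrow> Ck_on k S (f i)"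
  shows "Ck_on k S (\<lambda>x. \<Sum>i\<in>I. f i x)"
  using assms(2)
  by (induction I rule: infinite_finite_induct) (simp_all add: Ck_on_const Ck_on_add assms(1))

lemma Ck_on_scaleR:
  assumes "open S"
  shows "Ck_on k S a \<Longrightarrow> Ck_on k S f \<Longrightarrow> Ck_on k S (\<lambda>x. a x *\<^sub>R f x)"
proof (induction k arbitrary: a f)
  case 0
  then show ?case by (simp add: continuous_on_scaleR)
next
  case (Suc k)
  have "Ck_on k S (\<lambda>x. a x *\<^sub>R frechet_derivative f (at x) v +
      frechet_derivative a (at x) v *\<^sub>R f x)" for v
    using Suc Ck_on_SucD[OF Suc.prems(1)] Ck_on_SucD[OF Suc.prems(2)]
    by (intro Ck_on_add[OF assms] Suc.IH) simp_all
  then show ?case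
    by (subst Ck_on_Suc_iff[OF assms, OF has_derivative_scaleR])
      (auto intro: Ck_on_Suc_has_derivative[OF Suc.prems(1)]
        Ck_on_Suc_has_derivative[OF Suc.prems(2)])
qed

lemma Ck_on_bounded_linear:
  assumes "open S" "bounded_linear L"
  shows "Ck_on k S f \<Longrightarrow> Ck_on k S (\<lambda>x. L (f x))"
proof (induction k arbitrary: f)
  case 0
  then show ?case by (simp add: bounded_linear.continuous_on[OF assms(2)])
next
  case (Suc k)
  have "Ck_on k S (\<lambda>x. L (frechet_derivative f (at x) v))" for v
    using Suc by simp
  then show ?case
    by (subst Ck_on_Suc_iff[OF assms(1), OF bounded_linear.has_derivative[OF assms(2)]])
      (auto intro: Ck_on_Suc_has_derivative[OF Suc.prems(1)])
qed

text \<open>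
  The class \<open>C\<^sup>k\<close> is defined through directional derivatives in constant directions, so in the
  chain rule the direction \<open>Dg(x) v\<close> is first expanded in an orthonormal basis.
\<close>

lemma Ck_on_compose:
  fixes g :: "'d::real_normed_vector \<Rightarrow> 'e::euclidean_space"
    and f :: "'e \<Rightarrow> 'f::real_normed_vector"
  assumes "open S" "open T" "g ` S \<subseteq> T"
  shows "Ck_on k T f \<Longrightarrow> Ck_on k S g \<Longrightarrow> Ck_on k S (\<lambda>x. f (g x))"
proof (induction k arbitrary: f)
  case 0
  then show ?case
    using assms(3) by (auto intro: continuous_on_compose2)
next
  case (Suc k)
  let ?f' = "\<lambda>y. frechet_derivative f (at y)" and ?g' = "\<lambda>x. frechet_derivative g (at x)"
  have *: "Ck_on k S (\<lambda>x. \<Sum>b\<in>Basis. (?g' x v \<bullet> b) *\<^sub>R ?f' (g x) b)" for v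
    using Suc.prems
    by (intro Ck_on_sum[OF assms(1)] Ck_on_scaleR[OF assms(1)]
        Ck_on_bounded_linear[OF assms(1) bounded_linear_inner_left]
        Suc.IH[OF _ Ck_on_SucD[OF Suc.prems(2)]]) simp_all
  have "?f' (g x) (?g' x v) = (\<Sum>b\<in>Basis. (?g' x v \<bullet> b) *\<^sub>R ?f' (g x) b)" if "x \<in> S" for x v
  proof -
    have "g x \<in> T" using that assms(3) by auto
    then have "linear (?f' (g x))"
      using Ck_on_Suc_has_derivative[OF Suc.prems(1)] has_derivative_linear by blast
    then have "?f' (g x) (\<Sum>b\<in>Basis. (?g' x v \<bullet> b) *\<^sub>R b) =
        (\<Sum>b\<in>Basis. (?g' x v \<bullet> b) *\<^sub>R ?f' (g x) b)"
      by (simp add: linear_sum linear_scale)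
    then show ?thesis by (simp add: euclidean_representation)
  qed
  then have "Ck_on k S (\<lambda>x. ?f' (g x) (?g' x v))" for v
    by (subst Ck_on_cong[OF assms(1)]) (auto intro: *)
  moreover have "((\<lambda>x. f (g x)) has_derivative (\<lambda>v. ?f' (g x) (?g' x v))) (at x)" if "x \<in> S" for x
  proof -
    have "(g has_derivative ?g' x) (at x)"
      using Suc.prems(2) that by (rule Ck_on_Suc_has_derivative)
    have "g x \<in> T" using that assms(3) by auto
    with Suc.prems(1) have "(f has_derivative ?f' (g x)) (at (g x))"
      by (rule Ck_on_Suc_has_derivative)
    with \<open>(g has_derivative ?g' x) (at x)\<close> show ?thesis
      by (rule has_derivative_compose)
  qed
  ultimately show ?case
    using Ck_on_Suc_iff[OF assms(1), of "\<lambda>x. f (g x)" "\<lambda>x v. ?f' (g x) (?g' x v)"] by blast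
qed

lemma smooth_on_subset: "smooth_on S f \<Longrightarrow> T \<subseteq> S \<Longrightarrow> smooth_on T f"
  unfolding smooth_on_def using Ck_on_subset by blast

lemma smooth_on_cong:
  "open S \<Longrightarrow> (\<And>x. x \<in> S \<Longrightarrow> f x = g x) \<Longrightarrow> smooth_on S f \<longleftrightarrow> smooth_on S g"
  unfolding smooth_on_def using Ck_on_cong[of S f g] by blast

lemma smooth_on_const: "open S \<Longrightarrow> smooth_on S (\<lambda>x. c)"
  by (simp add: smooth_on_def Ck_on_const)

lemma smooth_on_add:
  "open S \<Longrightarrow> smooth_on S f \<Longrightarrow> smooth_on S g \<Longrightarrow> smooth_on S (\<lambda>x. f x + g x)"
  by (simp add: smooth_on_def Ck_on_add)

lemma smooth_on_sum:
  "open S \<Longrightarrow> (\<And>i. i \<in> I \<Longrightarrow> smooth_on S (f i)) \<Longrightarrow> smooth_on S (\<lambda>x. \<Sum>i\<in>I. f i x)"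
  by (simp add: smooth_on_def Ck_on_sum)

lemma smooth_on_scaleR:
  "open S \<Longrightarrow> smooth_on S a \<Longrightarrow> smooth_on S f \<Longrightarrow> smooth_on S (\<lambda>x. a x *\<^sub>R f x)"
  by (simp add: smooth_on_def Ck_on_scaleR)

lemma smooth_on_bounded_linear:
  "open S \<Longrightarrow> bounded_linear L \<Longrightarrow> smooth_on S f \<Longrightarrow> smooth_on S (\<lambda>x. L (f x))"
  by (simp add: smooth_on_def Ck_on_bounded_linear)

lemma smooth_on_compose:
  fixes g :: "'d::real_normed_vector \<Rightarrow> 'e::euclidean_space"
  shows "open S \<Longrightarrow> open T \<Longrightarrow> g ` S \<subseteq> T \<Longrightarrow> smooth_on T f \<Longrightarrow> smooth_on S g \<Longrightarrow>
    smooth_on S (\<lambda>x. f (g x))"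
  by (simp add: smooth_on_def Ck_on_compose)

lemma smooth_on_has_derivative:
  "smooth_on S f \<Longrightarrow> x \<in> S \<Longrightarrow> (f has_derivative frechet_derivative f (at x)) (at x)"
  unfolding smooth_on_def using Ck_on_Suc_has_derivative[of 0] by blast

lemma smooth_on_frechet_derivative:
  "smooth_on S f \<Longrightarrow> smooth_on S (\<lambda>x. frechet_derivative f (at x) v)"
  unfolding smooth_on_def by (metis Ck_on.simps(2))

lemma smooth_on_imp_continuous_on: "smooth_on S f \<Longrightarrow> continuous_on S f"
  unfolding smooth_on_def by (metis Ck_on.simps(1))


section \<open>Linear algebra of one tangent space\<close>

lemma linear_onD:
  assumes "linear_on T f"
  shows linear_on_add: "u \<in> T \<Longrightarrow> v \<in> T \<Longrightarrow> f (u + v) = f u + f v"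
    and linear_on_scale: "v \<in> T \<Longrightarrow> f (c *\<^sub>R v) = c *\<^sub>R f v"
  using assms by (auto simp: linear_on_def)

lemma linear_on_diff:
  assumes "linear_on T f" "subspace T" "u \<in> T" "v \<in> T"
  shows "f (u - v) = f u - f v"
  using linear_on_add[OF assms(1,3), of "(- 1) *\<^sub>R v"] linear_on_scale[OF assms(1,4), of "- 1"]
    subspace_scale[OF assms(2,4), of "- 1"] by simp

lemma linear_on_sum:
  assumes "linear_on T f" "subspace T" "\<And>i. i \<in> I \<Longrightarrow> v i \<in> T"
  shows "f (\<Sum>i\<in>I. v i) = (\<Sum>i\<in>I. f (v i))"
proof -
  have "f 0 = 0"
    using linear_on_scale[OF assms(1) subspace_0[OF assms(2)], of 0] by simp
  then show ?thesis
    using assms(3)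
    by (induction I rule: infinite_finite_induct)
      (simp_all add: linear_on_add[OF assms(1)] subspace_sum[OF assms(2)])
qed

lemma linear_on_subset: "linear_on T f \<Longrightarrow> S \<subseteq> T \<Longrightarrow> linear_on S f"
  unfolding linear_on_def by blast

definition eigenspace :: "'v::real_vector set \<Rightarrow> ('v \<Rightarrow> 'v) \<Rightarrow> real \<Rightarrow> 'v set" where
  "eigenspace T f c = {v \<in> T. f v = c *\<^sub>R v}"

lemma direct_sum3I:
  assumes "subspace U" "subspace V" "subspace W" "U \<subseteq> T" "V \<subseteq> T" "W \<subseteq> T"
    and ex: "\<And>t. t \<in> T \<Longrightarrow> \<exists>u\<in>U. \<exists>v\<in>V. \<exists>w\<in>W. t = u + v + w"
    and zero: "\<And>u v w. u \<in> U \<Longrightarrow> v \<in> V \<Longrightarrow> w \<in> W \<Longrightarrow> u + v + w = 0 \<Longrightarrow> u = 0 \<and> v = 0 \<and> w = 0"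
  shows "direct_sum3 T U V W"
  unfolding direct_sum3_def
proof (intro conjI ballI)
  fix t assume "t \<in> T"
  from ex[OF this] obtain u v w where uvw: "u \<in> U" "v \<in> V" "w \<in> W" "t = u + v + w"
    by (elim bexE)
  have uniq: "u' = u \<and> v' = v \<and> w' = w"
    if "u' \<in> U" "v' \<in> V" "w' \<in> W" "t = u' + v' + w'" for u' v' w'
  proof -
    have "(u' - u) + (v' - v) + (w' - w) = (u' + v' + w') - (u + v + w)"
      by (simp add: algebra_simps)
    then have "(u' - u) + (v' - v) + (w' - w) = 0"
      by (simp flip: that(4) uvw(4))
    then show ?thesis
      using zero[of "u' - u" "v' - v" "w' - w"] that(1-3) uvw(1-3) assms(1-3)
      by (simp add: subspace_diff)
  qed
  show "\<exists>!(u, v, w). u \<in> U \<and> v \<in> V \<and> w \<in> W \<and> t = u + v + w"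
  proof (rule ex1I[of _ "(u, v, w)"])
    show "case (u, v, w) of (u, v, w) \<Rightarrow> u \<in> U \<and> v \<in> V \<and> w \<in> W \<and> t = u + v + w"
      using uvw by simp
    show "y = (u, v, w)"
      if "case y of (u, v, w) \<Rightarrow> u \<in> U \<and> v \<in> V \<and> w \<in> W \<and> t = u + v + w" for y
    proof (cases y)
      case (fields u' v' w')
      with that uniq[of u' v' w'] show ?thesis by simp
    qed
  qed
qed (fact assms)+

text \<open>
  For a linear map \<open>f\<close> with \<open>f\<^sup>3 = f\<close> and \<open>s = \<plusminus>1\<close>, this is the projection onto the eigenspace for
  \<open>s\<close> along the sum of the eigenspaces for \<open>0\<close> and \<open>- s\<close>.
\<close>

definition eigenprojection :: "('v::real_vector \<Rightarrow> 'v) \<Rightarrow> real \<Rightarrow> 'v \<Rightarrow> 'v" where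
  "eigenprojection f s v = (1 / 2) *\<^sub>R (f (f v) + s *\<^sub>R f v)"

text \<open>
  The situation in a single tangent space \<open>T\<close>: \<open>f\<close>, \<open>h\<close> and \<open>x\<close> stand for the values of \<open>\<phi>\<^sub>\<alpha>\<close>, \<open>\<eta>\<close>
  and \<open>\<xi>\<close> at the point. The maps are linear only on \<open>T\<close>, since outside the tangent space the
  fields have arbitrary values.
\<close>

locale paracontact_endomorphism =
  fixes T :: "'v::real_vector set" and f :: "'v \<Rightarrow> 'v" and h :: "'v \<Rightarrow> real" and x :: 'v
  assumes subspace: "subspace T"
    and linear: "linear_on T f"
    and maps: "v \<in> T \<Longrightarrow> f v \<in> T"
    and form: "linear_on T h"
    and vector: "x \<in> T"
    and form_vector: "h x = 1"
    and square: "v \<in> T \<Longrightarrow> f (f v) = v - h v *\<^sub>R x"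
begin

lemmas f_add = linear_on_add[OF linear]
lemmas f_scale = linear_on_scale[OF linear]
lemmas f_diff = linear_on_diff[OF linear subspace]
lemmas h_add = linear_on_add[OF form]
lemmas h_scale = linear_on_scale[OF form]
lemmas h_diff = linear_on_diff[OF form subspace]
lemmas T_closed = subspace_add[OF subspace] subspace_diff[OF subspace] subspace_scale[OF subspace]
  subspace_0[OF subspace] maps vector

lemma f_zero: "f 0 = 0"
  using f_scale[OF vector, of 0] by simp

text \<open>
  Since \<open>f (f x) = 0\<close>, the relation for \<open>f\<^sup>2\<close> at \<open>f x\<close> shows that \<open>f x = c x\<close> for some \<open>c\<close>. Then
  \<open>0 = f (f x) = c (f x)\<close>, so that \<open>c = 0\<close> or \<open>f x = 0\<close>.
\<close>

lemma f_vector: "f x = 0"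
proof -
  let ?w = "f x"
  have "f ?w = 0"
    using square[OF vector] by (simp add: form_vector)
  then have w: "?w = h ?w *\<^sub>R x"
    using square[OF maps[OF vector]] f_zero by simp
  then have "f ?w = h ?w *\<^sub>R ?w"
    using f_scale[OF vector] by metis
  with \<open>f ?w = 0\<close> w show ?thesis by auto
qed

text \<open>
  The two ways to evaluate \<open>f\<^sup>3 v\<close> differ by \<open>h (f v) x\<close>.
\<close>

lemma form_f: "v \<in> T \<Longrightarrow> h (f v) = 0"
proof -
  assume v: "v \<in> T"
  have "f v - h (f v) *\<^sub>R x = f (f (f v))"
    using square[OF maps[OF v]] by simp
  also have "\<dots> = f v"
    using v by (simp add: square f_diff f_scale f_vector T_closed)
  finally have "h (f v) *\<^sub>R x = 0" by simp
  then show ?thesis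
    using h_scale[OF vector, of "h (f v)"] h_scale[OF vector, of 0] form_vector by auto
qed

lemma eigenspace_subset: "eigenspace T f c \<subseteq> T"
  by (auto simp: eigenspace_def)

lemma subspace_eigenspace: "subspace (eigenspace T f c)"
  by (rule subspaceI)
    (auto simp: eigenspace_def T_closed f_zero f_add f_scale scaleR_add_right scaleR_left_commute)

lemma form_eigenspace: "v \<in> eigenspace T f c \<Longrightarrow> c \<noteq> 0 \<Longrightarrow> h v = 0"
  using form_f[of v] h_scale[of v c] by (auto simp: eigenspace_def)

lemma square_kernel: "v \<in> T \<Longrightarrow> h v = 0 \<Longrightarrow> f (f v) = v"
  by (simp add: square)

lemma image_eigenspace_self:
  assumes "c \<noteq> 0"
  shows "f ` eigenspace T f c = eigenspace T f c"
proof -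
  have "f ` eigenspace T f c = (*\<^sub>R) c ` eigenspace T f c"
    by (intro image_cong) (auto simp: eigenspace_def)
  also have "\<dots> = eigenspace T f c"
  proof
    show "(*\<^sub>R) c ` eigenspace T f c \<subseteq> eigenspace T f c"
      using subspace_scale[OF subspace_eigenspace] by blast
    show "eigenspace T f c \<subseteq> (*\<^sub>R) c ` eigenspace T f c"
      using subspace_scale[OF subspace_eigenspace, of _ c "1 / c"] assms
      by (auto intro!: image_eqI[where x = "(1 / c) *\<^sub>R _"])
  qed
  finally show ?thesis .
qed

lemma eigenprojection_eigenspace:
  assumes "s \<in> {1, -1}" "v \<in> T"
  shows "eigenprojection f s v \<in> eigenspace T f s"
proof -
  have "f (f (f v)) = f v"
    using assms by (simp add: square_kernel form_f maps)
  moreover have "s * s = 1" using assms(1) by auto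
  ultimately show ?thesis
    using assms(2)
    by (simp add: eigenprojection_def eigenspace_def f_scale f_add T_closed scaleR_add_right add.commute)
qed

lemma eigenprojection_fixes: "s \<in> {1, -1} \<Longrightarrow> v \<in> eigenspace T f s \<Longrightarrow> eigenprojection f s v = v"
  by (auto simp: eigenprojection_def eigenspace_def f_scale simp flip: scaleR_add_left)

lemma direct_sum3_eigenspaces:
  "direct_sum3 T (eigenspace T f 1) (eigenspace T f (-1)) (span {x})"
proof (rule direct_sum3I)
  fix t assume t: "t \<in> T"
  \<comment> \<open>The two projections add up to \<open>f\<^sup>2\<close>, which leaves the component along \<open>x\<close>.\<close>
  have "t = eigenprojection f 1 t + eigenprojection f (-1) t + h t *\<^sub>R x"
    by (simp add: eigenprojection_def square[OF t] flip: scaleR_add_right)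
  moreover have "h t *\<^sub>R x \<in> span {x}"
    by (simp add: span_base span_scale)
  ultimately show "\<exists>u\<in>eigenspace T f 1. \<exists>v\<in>eigenspace T f (-1). \<exists>w\<in>span {x}. t = u + v + w"
    using eigenprojection_eigenspace[OF _ t] by blast
next
  fix u v w
  assume u: "u \<in> eigenspace T f 1" and v: "v \<in> eigenspace T f (-1)" and "w \<in> span {x}"
    and sum: "u + v + w = 0"
  then obtain c where w: "w = c *\<^sub>R x"
    by (auto simp: span_singleton)
  have T: "u \<in> T" "v \<in> T" using u v by (auto simp: eigenspace_def)
  have "f (u + v + w) = u - v"
    using u v T by (simp add: w f_add f_scale f_vector T_closed eigenspace_def)
  then have "u = v" using sum f_zero by simp
  have "h (u + v + w) = c"
    using form_eigenspace[OF u] form_eigenspace[OF v] T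
    by (simp add: w h_add h_scale form_vector T_closed)
  then have "c = 0" using sum h_scale[OF vector, of 0] by simp
  with sum w \<open>u = v\<close> have "2 *\<^sub>R u = 0" by (simp add: scaleR_2)
  then show "u = 0 \<and> v = 0 \<and> w = 0" using \<open>u = v\<close> w \<open>c = 0\<close> by simp
qed (use subspace_eigenspace eigenspace_subset span_minimal[OF _ subspace] vector in auto)

end

locale anticommuting_paracontact_pair =
  f: paracontact_endomorphism T f h x + g: paracontact_endomorphism T g h x
  for T :: "'v::real_vector set" and f g h x +
  assumes anticommute: "v \<in> T \<Longrightarrow> f (g v) = - g (f v)"
begin

lemma swap: "anticommuting_paracontact_pair T g f h x"
  by unfold_locales (simp add: anticommute)

lemma f_maps_eigenspace: "v \<in> eigenspace T g c \<Longrightarrow> f v \<in> eigenspace T g (- c)"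
  using anticommute[of v] by (auto simp: eigenspace_def f.maps f.f_scale)

text \<open>
  Eigenvectors for nonzero eigenvalues lie in the kernel of \<open>h\<close>, where \<open>f\<close> is its own inverse.
\<close>

lemma bij_betw_eigenspaces:
  assumes "c \<noteq> 0"
  shows "bij_betw f (eigenspace T g c) (eigenspace T g (- c))"
proof (rule bij_betwI[where g = f])
  show "f \<in> eigenspace T g c \<rightarrow> eigenspace T g (- c)"
    "f \<in> eigenspace T g (- c) \<rightarrow> eigenspace T g c"
    using f_maps_eigenspace[of _ c] f_maps_eigenspace[of _ "- c"] by auto
  show "f (f v) = v" if "v \<in> eigenspace T g c" for v
    using that g.form_eigenspace[OF that assms] by (auto simp: eigenspace_def f.square_kernel)
  show "f (f v) = v" if "v \<in> eigenspace T g (- c)" for v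
    using that g.form_eigenspace[OF that] assms by (auto simp: eigenspace_def f.square_kernel)
qed

lemma image_eigenspace: "c \<noteq> 0 \<Longrightarrow> f ` eigenspace T g c = eigenspace T g (- c)"
  using bij_betw_eigenspaces by (simp add: bij_betw_def)

text \<open>
  If \<open>w = u + v\<close> with \<open>f u = s u\<close> and \<open>g v = t v\<close>, then \<open>f w - s w = f v - s v\<close>. Here \<open>f v\<close> lies in
  the eigenspace of \<open>g\<close> for \<open>- t\<close> and is killed by \<open>I + t g\<close>, so \<open>v = (I + t g) (I - s f) w / 2\<close>.
  This formula, with \<open>u = w - v\<close>, decomposes every \<open>w\<close> in the kernel of \<open>h\<close>. The sum is direct,
  because on a common eigenvector \<open>f\<close> and \<open>g\<close> would commute as well as anticommute.
\<close>

lemma direct_sum3_mixed_eigenspaces: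
  assumes s: "s \<in> {1, -1}" and t: "t \<in> {1, -1}"
  shows "direct_sum3 T (eigenspace T f s) (eigenspace T g t) (span {x})"
proof (rule direct_sum3I)
  have st: "s * s = 1" "t * t = 1" "s \<noteq> 0" "t \<noteq> 0" using s t by auto
  {
    fix y assume y: "y \<in> T"
    define w where "w = y - h y *\<^sub>R x"
    have w: "w \<in> T" "h w = 0"
      using y by (simp_all add: w_def f.T_closed f.h_diff f.h_scale f.form_vector)
    \<comment> \<open>The decomposition takes place in the span of \<open>w, f w, g w, g (f w)\<close>, which both maps preserve.\<close>
    define a b where "a = f w" and "b = g w"
    have ab: "a \<in> T" "b \<in> T" "f a = w" "g b = w"
      using w by (simp_all add: a_def b_def f.maps g.maps f.square_kernel g.square_kernel)
    define d where "d = g a"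
    have d: "d \<in> T" "g d = a" "f b = - d" "f d = - b"
      using w ab by (simp_all add: a_def b_def d_def g.maps g.square_kernel f.form_f anticommute)
    define u v where "u = (1 / 2) *\<^sub>R (w + s *\<^sub>R a - t *\<^sub>R b + (s * t) *\<^sub>R d)"
      and "v = (1 / 2) *\<^sub>R (w - s *\<^sub>R a + t *\<^sub>R b - (s * t) *\<^sub>R d)"
    have "f u = (1 / 2) *\<^sub>R (a + s *\<^sub>R w + t *\<^sub>R d - (s * t) *\<^sub>R b)"
      using w ab d by (simp add: u_def f.f_scale f.f_add f.f_diff f.T_closed flip: a_def)
    also have "\<dots> = s *\<^sub>R u"
      using s t by (auto simp: u_def algebra_simps)
    finally have u: "u \<in> eigenspace T f s"
      using w ab d by (simp add: u_def eigenspace_def f.T_closed)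
    have "g v = (1 / 2) *\<^sub>R (b - s *\<^sub>R d + t *\<^sub>R w - (s * t) *\<^sub>R a)"
      using w ab d by (simp add: v_def g.f_scale g.f_add g.f_diff g.T_closed flip: b_def d_def)
    also have "\<dots> = t *\<^sub>R v"
      using s t by (auto simp: v_def algebra_simps)
    finally have v: "v \<in> eigenspace T g t"
      using w ab d by (simp add: v_def eigenspace_def f.T_closed)
    have "u + v = w"
      by (simp add: u_def v_def flip: scaleR_add_right)
    then have "y = u + v + h y *\<^sub>R x"
      by (simp add: w_def)
    moreover have "h y *\<^sub>R x \<in> span {x}"
      by (simp add: span_base span_scale)
    ultimately show "\<exists>u\<in>eigenspace T f s. \<exists>v\<in>eigenspace T g t. \<exists>w\<in>span {x}. y = u + v + w"
      using u v by blast
  }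
  fix u v w
  assume u: "u \<in> eigenspace T f s" and v: "v \<in> eigenspace T g t" and "w \<in> span {x}"
    and sum: "u + v + w = 0"
  then obtain c where w: "w = c *\<^sub>R x"
    by (auto simp: span_singleton)
  have T: "u \<in> T" "v \<in> T" using u v by (auto simp: eigenspace_def)
  have "h (u + v + w) = c"
    using f.form_eigenspace[OF u] g.form_eigenspace[OF v] T st
    by (simp add: w f.h_add f.h_scale f.form_vector f.T_closed)
  then have "c = 0" using sum f.h_scale[OF f.vector, of 0] by simp
  with sum w have vu: "v = (- 1) *\<^sub>R u" by (simp add: add_eq_0_iff)
  then have "u \<in> eigenspace T g t"
    using subspace_scale[OF g.subspace_eigenspace v, of "- 1"] by simp
  then have "(s * t) *\<^sub>R u = - ((s * t) *\<^sub>R u)"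
    using u anticommute[OF T(1)]
    by (simp add: eigenspace_def f.f_scale g.f_scale mult.commute)
  then have "u = 0" using st by (simp add: eq_neg_iff_add_eq_0 flip: scaleR_2)
  then show "u = 0 \<and> v = 0 \<and> w = 0" using vu w \<open>c = 0\<close> by simp
qed (use f.subspace_eigenspace f.eigenspace_subset g.subspace_eigenspace g.eigenspace_subset
      span_minimal[OF _ f.subspace] f.vector in auto)

end


section \<open>Bases and dimensions\<close>

lemma direct_sum3_zeroD:
  assumes "direct_sum3 T U V W" "u \<in> U" "v \<in> V" "w \<in> W" "u + v + w = 0"
  shows "u = 0 \<and> v = 0 \<and> w = 0"
proof -
  have "subspace U" "subspace V" "subspace W" "U \<subseteq> T"
    and ex1: "\<forall>t\<in>T. \<exists>!(a, b, c). a \<in> U \<and> b \<in> V \<and> c \<in> W \<and> t = a + b + c"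
    using assms(1) unfolding direct_sum3_def by - (elim conjE, assumption)+
  then have 0: "0 \<in> U" "0 \<in> V" "0 \<in> W" "0 \<in> T"
    by (auto simp: subspace_0)
  have unique: "a = b" if "\<exists>!x. P x" "P a" "P b" for P and a b :: "'a \<times> 'a \<times> 'a"
    using that by blast
  have "(u, v, w) = (0, 0, 0)"
    by (rule unique[OF bspec[OF ex1 0(4)]]) (simp_all add: assms(2-5) 0(1-3))
  then show ?thesis by simp
qed

lemma dim_direct_sum3_UNIV:
  fixes U V W :: "'e::euclidean_space set"
  assumes "direct_sum3 UNIV U V W"
  shows "dim U + dim V + dim W = DIM('e)"
proof -
  note sub = assms[unfolded direct_sum3_def]
  let ?UV = "{u + v | u v. u \<in> U \<and> v \<in> V}"
  note zero = direct_sum3_zeroD[OF assms]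
  have UV: "subspace ?UV"
    using sub by (intro subspace_sums) auto
  have "U \<inter> V \<subseteq> {0}"
  proof
    fix u assume u: "u \<in> U \<inter> V"
    then have "- u \<in> V" "0 \<in> W" using sub by (auto simp: subspace_neg subspace_0)
    with u zero[of u "- u" 0] show "u \<in> {0}" by simp
  qed
  moreover have "?UV \<inter> W \<subseteq> {0}"
  proof
    fix w assume w: "w \<in> ?UV \<inter> W"
    then obtain u v where uv: "u \<in> U" "v \<in> V" "w = u + v" by blast
    have "- w \<in> W" using w sub by (auto simp: subspace_neg)
    with uv zero[of u v "- w"] show "w \<in> {0}" by simp
  qed
  moreover have "{x + w | x w. x \<in> ?UV \<and> w \<in> W} = UNIV"
    using sub by blast
  ultimately show ?thesis
    using dim_sums_Int[of U V] dim_sums_Int[OF UV, of W] sub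
    by (auto simp: dim_eq_0[THEN iffD2])
qed

text \<open>
  Coefficients indexed by \<open>I\<close> also detect repetitions in the family, which independence of its
  range does not.
\<close>

lemma independent_familyI:
  fixes y :: "'i \<Rightarrow> 'v::real_vector"
  assumes "finite I"
    and indep: "\<And>c. (\<Sum>i\<in>I. c i *\<^sub>R y i) = 0 \<Longrightarrow> \<forall>i\<in>I. c i = 0"
  shows "inj_on y I" "independent (y ` I)"
proof -
  show inj: "inj_on y I"
  proof (rule inj_onI, rule ccontr)
    fix i j assume ij: "i \<in> I" "j \<in> I" "y i = y j" "i \<noteq> j"
    \<comment> \<open>Two equal members give the nontrivial relation \<open>y i - y j = 0\<close>.\<close>
    let ?c = "\<lambda>k. if k = i then 1 else if k = j then -1 else 0 :: real"
    have "(\<Sum>k\<in>I. ?c k *\<^sub>R y k) = (\<Sum>k\<in>{i, j}. ?c k *\<^sub>R y k)"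
      using assms(1) ij by (intro sum.mono_neutral_right) auto
    also have "\<dots> = 0" using ij by simp
    finally show False using indep[of ?c] ij by auto
  qed
  show "independent (y ` I)"
  proof (rule independent_if_scalars_zero)
    fix u v assume "(\<Sum>x\<in>y ` I. u x *\<^sub>R x) = 0" "v \<in> y ` I"
    then have "(\<Sum>i\<in>I. u (y i) *\<^sub>R y i) = 0"
      by (simp only: sum.reindex[OF inj] o_def)
    with indep[of "\<lambda>i. u (y i)"] \<open>v \<in> y ` I\<close> show "u v = 0"
      by blast
  qed (use assms(1) in simp)
qed

text \<open>
  Linear independence is an open condition. Against linear forms dual to the given independent
  vectors, the nearby vectors have a matrix close to the identity, hence strictly diagonally
  dominant; such a matrix annihilates no coefficient vector, as its largest entry shows.
\<close>

lemma eventually_independent_family: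
  fixes y :: "'i \<Rightarrow> 'd::topological_space \<Rightarrow> 'e::euclidean_space"
  assumes fin: "finite I"
    and tendsto: "\<And>i. i \<in> I \<Longrightarrow> (y i \<longlongrightarrow> b i) F"
    and b: "inj_on b I" "independent (b ` I)"
  shows "eventually (\<lambda>x. inj_on (\<lambda>i. y i x) I \<and> independent ((\<lambda>i. y i x) ` I)) F"
proof -
  have "\<forall>j. \<exists>g. linear g \<and> (\<forall>v\<in>b ` I. g v = (if v = b j then 1 else 0 :: real))"
    by (intro allI linear_independent_extend[OF b(2)])
  from choice[OF this] obtain g :: "'i \<Rightarrow> 'e \<Rightarrow> real" where
    g: "\<forall>j. linear (g j) \<and> (\<forall>v\<in>b ` I. g j v = (if v = b j then 1 else 0))"
    by (elim exE)
  then have g_linear: "linear (g j)" and g_b: "i \<in> I \<Longrightarrow> g j (b i) = (if b i = b j then 1 else 0)" for i j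
    by auto
  let ?d = "\<lambda>i j. if i = j then 1 else 0 :: real"
  \<comment> \<open>Small enough for the deviations from the identity in one row to sum to less than one.\<close>
  define \<epsilon> where "\<epsilon> = 1 / (real (card I) + 1)"
  have "\<epsilon> > 0" by (simp add: \<epsilon>_def)
  have "((\<lambda>x. g j (y i x)) \<longlongrightarrow> ?d i j) F" if "i \<in> I" "j \<in> I" for i j
  proof -
    have "((\<lambda>x. g j (y i x)) \<longlongrightarrow> g j (b i)) F"
      using g_linear[of j] tendsto[OF that(1)]
      by (metis bounded_linear.tendsto linear_conv_bounded_linear)
    also have "g j (b i) = ?d i j"
      using that b(1) by (auto simp: g_b inj_on_eq_iff)
    finally show ?thesis .
  qed
  from tendstoD[OF this \<open>\<epsilon> > 0\<close>]
  have "eventually (\<lambda>x. \<bar>g j (y i x) - ?d i j\<bar> < \<epsilon>) F" if "i \<in> I" "j \<in> I" for i j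
    using that unfolding dist_real_def .
  then have "eventually (\<lambda>x. \<forall>i\<in>I. \<forall>j\<in>I. \<bar>g j (y i x) - ?d i j\<bar> < \<epsilon>) F"
    using fin by (simp add: eventually_ball_finite_distrib)
  then show ?thesis
  proof (rule eventually_mono)
    fix x assume close: "\<forall>i\<in>I. \<forall>j\<in>I. \<bar>g j (y i x) - ?d i j\<bar> < \<epsilon>"
    have "\<forall>i\<in>I. c i = 0" if "(\<Sum>i\<in>I. c i *\<^sub>R y i x) = 0" for c
    proof (rule ccontr)
      assume "\<not> (\<forall>i\<in>I. c i = 0)"
      then have "I \<noteq> {}" by auto
      define m where "m = Max ((\<lambda>i. \<bar>c i\<bar>) ` I)"
      have "m \<in> (\<lambda>i. \<bar>c i\<bar>) ` I"
        unfolding m_def using fin \<open>I \<noteq> {}\<close> by (intro Max_in) auto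
      then obtain j where j: "j \<in> I" "m = \<bar>c j\<bar>" by blast
      have max: "\<bar>c i\<bar> \<le> \<bar>c j\<bar>" if "i \<in> I" for i
        using fin that unfolding j(2)[symmetric] m_def by (intro Max_ge) auto
      have pos: "\<bar>c j\<bar> > 0"
        using \<open>\<not> (\<forall>i\<in>I. c i = 0)\<close> max by fastforce
      have "0 = g j (\<Sum>i\<in>I. c i *\<^sub>R y i x)"
        using that g_linear[of j] by (simp add: linear_0)
      also have "\<dots> = (\<Sum>i\<in>I. c i * g j (y i x))"
        using g_linear[of j] by (simp add: linear_sum linear_scale)
      also have "\<dots> = (\<Sum>i\<in>I. c i * (g j (y i x) - ?d i j)) + (\<Sum>i\<in>I. c i * ?d i j)"
        by (simp add: algebra_simps flip: sum.distrib)
      also have "(\<Sum>i\<in>I. c i * ?d i j) = c j"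
        using fin j by (simp add: if_distrib cong: if_cong)
      finally have "\<bar>c j\<bar> = \<bar>\<Sum>i\<in>I. c i * (g j (y i x) - ?d i j)\<bar>" by linarith
      also have "\<dots> \<le> (\<Sum>i\<in>I. \<bar>c j\<bar> * \<epsilon>)"
      proof (intro order_trans[OF sum_abs] sum_mono)
        fix i assume i: "i \<in> I"
        with close j have "\<bar>g j (y i x) - ?d i j\<bar> \<le> \<epsilon>" by (meson less_imp_le)
        then show "\<bar>c i * (g j (y i x) - ?d i j)\<bar> \<le> \<bar>c j\<bar> * \<epsilon>"
          unfolding abs_mult using max[OF i] by (intro mult_mono) auto
      qed
      also have "\<dots> < \<bar>c j\<bar>"
        using pos by (simp add: \<epsilon>_def field_simps)
      finally show False by simp
    qed
    then show "inj_on (\<lambda>i. y i x) I \<and> independent ((\<lambda>i. y i x) ` I)"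
      using independent_familyI[OF fin, of "\<lambda>i. y i x"] by blast
  qed
qed


section \<open>Charts and tangent vectors\<close>

locale smooth_atlas =
  fixes M :: "'a topology" and A :: "('a, 'e::euclidean_space) chart set"
  assumes smooth_manifold: "smooth_manifold M A"
begin

lemma
  assumes "\<kappa> \<in> A"
  shows openin_chart: "openin M (fst \<kappa>)"
    and open_chart_image: "open (snd \<kappa> ` fst \<kappa>)"
    and homeomorphic_chart:
      "homeomorphic_map (subtopology M (fst \<kappa>)) (top_of_set (snd \<kappa> ` fst \<kappa>)) (snd \<kappa>)"
  using smooth_manifold assms unfolding smooth_manifold_def case_prod_beta by blast+

lemma chart_around: "p \<in> topspace M \<Longrightarrow> \<exists>\<kappa>\<in>A. p \<in> fst \<kappa>"
  using smooth_manifold by (auto simp: smooth_manifold_def)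

lemma topspace_chart: "\<kappa> \<in> A \<Longrightarrow> topspace (subtopology M (fst \<kappa>)) = fst \<kappa>"
  by (simp add: openin_subset[OF openin_chart] Int_absorb1)

lemma inj_on_chart: "\<kappa> \<in> A \<Longrightarrow> inj_on (snd \<kappa>) (fst \<kappa>)"
  using homeomorphic_imp_injective_map[OF homeomorphic_chart] by (simp only: topspace_chart)

lemma chart_inv_chart [simp]: "\<kappa> \<in> A \<Longrightarrow> p \<in> fst \<kappa> \<Longrightarrow> chart_inv \<kappa> (snd \<kappa> p) = p"
  by (simp add: chart_inv_def inj_on_chart)

lemma open_chart_image_Int:
  assumes "\<kappa> \<in> A" "openin M V"
  shows "open (snd \<kappa> ` (fst \<kappa> \<inter> V))"
proof -
  have "openin (subtopology M (fst \<kappa>)) (fst \<kappa> \<inter> V)"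
    using assms(2) by (simp add: openin_subtopology_Int2)
  then have "openin (top_of_set (snd \<kappa> ` fst \<kappa>)) (snd \<kappa> ` (fst \<kappa> \<inter> V))"
    using homeomorphic_imp_open_map[OF homeomorphic_chart[OF assms(1)]]
    by (simp add: open_map_def)
  then show ?thesis
    using open_chart_image[OF assms(1)] openin_open_trans by blast
qed

lemma openin_chart_vimage:
  assumes "\<kappa> \<in> A" "open W"
  shows "openin M {q \<in> fst \<kappa>. snd \<kappa> q \<in> W}"
proof -
  have cont: "continuous_map (subtopology M (fst \<kappa>)) (top_of_set (snd \<kappa> ` fst \<kappa>)) (snd \<kappa>)"
    by (rule homeomorphic_imp_continuous_map[OF homeomorphic_chart[OF assms(1)]])
  then have "continuous_map (subtopology M (fst \<kappa>)) euclidean (snd \<kappa>)"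
    using continuous_map_in_subtopology by blast
  then have "openin (subtopology M (fst \<kappa>)) {q \<in> topspace (subtopology M (fst \<kappa>)). snd \<kappa> q \<in> W}"
    using assms(2) by (intro openin_continuous_map_preimage) auto
  then have "openin (subtopology M (fst \<kappa>)) {q \<in> fst \<kappa>. snd \<kappa> q \<in> W}"
    using assms(1) by (simp only: topspace_chart)
  then show ?thesis
    using openin_chart[OF assms(1)] openin_trans_full by blast
qed

lemma transition_chart: "\<kappa> \<in> A \<Longrightarrow> p \<in> fst \<kappa> \<Longrightarrow> transition \<kappa> \<kappa>' (snd \<kappa> p) = snd \<kappa>' p"
  by (simp add: transition_def)

lemma smooth_transition:
  "\<kappa> \<in> A \<Longrightarrow> \<kappa>' \<in> A \<Longrightarrow> smooth_on (snd \<kappa> ` (fst \<kappa> \<inter> fst \<kappa>')) (transition \<kappa> \<kappa>')"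
  using smooth_manifold by (auto simp: smooth_manifold_def)

abbreviation D_transition :: "('a, 'e) chart \<Rightarrow> ('a, 'e) chart \<Rightarrow> 'a \<Rightarrow> 'e \<Rightarrow> 'e" where
  "D_transition \<kappa> \<kappa>' p \<equiv> frechet_derivative (transition \<kappa> \<kappa>') (at (snd \<kappa> p))"

lemma transition_has_derivative:
  assumes "\<kappa> \<in> A" "\<kappa>' \<in> A" "p \<in> fst \<kappa>" "p \<in> fst \<kappa>'"
  shows "(transition \<kappa> \<kappa>' has_derivative D_transition \<kappa> \<kappa>' p) (at (snd \<kappa> p))"
  by (rule smooth_on_has_derivative[OF smooth_transition[OF assms(1,2)]]) (use assms(3,4) in auto)

lemma linear_D_transition:
  "\<kappa> \<in> A \<Longrightarrow> \<kappa>' \<in> A \<Longrightarrow> p \<in> fst \<kappa> \<Longrightarrow> p \<in> fst \<kappa>' \<Longrightarrow> linear (D_transition \<kappa> \<kappa>' p)"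
  using transition_has_derivative has_derivative_linear by blast

lemma D_transition_self:
  assumes "\<kappa> \<in> A" "p \<in> fst \<kappa>"
  shows "D_transition \<kappa> \<kappa> p = (\<lambda>e. e)"
proof -
  have "(transition \<kappa> \<kappa> has_derivative (\<lambda>e. e)) (at (snd \<kappa> p))"
    by (rule has_derivative_transform_within_open[OF has_derivative_ident open_chart_image[OF assms(1)]])
      (use assms in \<open>auto simp: transition_chart\<close>)
  then show ?thesis by (metis frechet_derivative_at)
qed

text \<open>
  The chain rule for transition maps; it says that \<open>chart_vec\<close> satisfies the transformation law.
\<close>

lemma D_transition_comp:
  assumes "\<kappa> \<in> A" "\<kappa>1 \<in> A" "\<kappa>2 \<in> A" "p \<in> fst \<kappa>" "p \<in> fst \<kappa>1" "p \<in> fst \<kappa>2"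
  shows "D_transition \<kappa>1 \<kappa>2 p (D_transition \<kappa> \<kappa>1 p e) = D_transition \<kappa> \<kappa>2 p e"
proof -
  have "((\<lambda>x. transition \<kappa>1 \<kappa>2 (transition \<kappa> \<kappa>1 x)) has_derivative
      (\<lambda>e. D_transition \<kappa>1 \<kappa>2 p (D_transition \<kappa> \<kappa>1 p e))) (at (snd \<kappa> p))"
    using transition_has_derivative[OF assms(1,2,4,5)] transition_has_derivative[OF assms(2,3,5,6)]
      transition_chart[OF assms(1,4), of \<kappa>1]
    by (metis has_derivative_compose)
  moreover have "open (snd \<kappa> ` (fst \<kappa> \<inter> fst \<kappa>1))"
    using open_chart_image_Int assms openin_chart by blast
  ultimately have "(transition \<kappa> \<kappa>2 has_derivative
      (\<lambda>e. D_transition \<kappa>1 \<kappa>2 p (D_transition \<kappa> \<kappa>1 p e))) (at (snd \<kappa> p))"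
    by (rule has_derivative_transform_within_open) (use assms in \<open>auto simp: transition_chart\<close>)
  then have "(\<lambda>e. D_transition \<kappa>1 \<kappa>2 p (D_transition \<kappa> \<kappa>1 p e)) = D_transition \<kappa> \<kappa>2 p"
    by (rule frechet_derivative_at)
  then show ?thesis by metis
qed

lemma chart_vec_tangent: "\<kappa> \<in> A \<Longrightarrow> p \<in> fst \<kappa> \<Longrightarrow> chart_vec A \<kappa> p e \<in> tangent_space A p"
  by (simp add: tangent_space_def chart_vec_def D_transition_comp)

lemma chart_vec_self: "\<kappa> \<in> A \<Longrightarrow> p \<in> fst \<kappa> \<Longrightarrow> chart_vec A \<kappa> p e \<kappa> = e"
  by (simp add: chart_vec_def D_transition_self)

text \<open>
  A tangent vector is determined by its component in any one chart. With the two preceding lemmas,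
  \<open>chart_vec A \<kappa> p\<close> identifies the model space with the tangent space.
\<close>

lemma chart_vec_component:
  assumes "\<kappa> \<in> A" "p \<in> fst \<kappa>" "v \<in> tangent_space A p"
  shows "chart_vec A \<kappa> p (v \<kappa>) = v"
proof
  fix \<kappa>'
  show "chart_vec A \<kappa> p (v \<kappa>) \<kappa>' = v \<kappa>'"
  proof (cases "\<kappa>' \<in> A \<and> p \<in> fst \<kappa>'")
    case True
    with assms have "v \<kappa>' = D_transition \<kappa> \<kappa>' p (v \<kappa>)"
      unfolding tangent_space_def by blast
    with True show ?thesis by (simp add: chart_vec_def)
  next
    case False
    with assms have "v \<kappa>' = 0"
      unfolding tangent_space_def by blast
    with False show ?thesis by (auto simp: chart_vec_def)
  qed
qed

lemma linear_chart_vec: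
  assumes "\<kappa> \<in> A" "p \<in> fst \<kappa>"
  shows "linear (chart_vec A \<kappa> p)"
proof (rule linearI)
  show "chart_vec A \<kappa> p (e + e') = chart_vec A \<kappa> p e + chart_vec A \<kappa> p e'" for e e'
    using linear_add[OF linear_D_transition] assms by (auto simp: chart_vec_def fun_eq_iff)
  show "chart_vec A \<kappa> p (c *\<^sub>R e) = c *\<^sub>R chart_vec A \<kappa> p e" for c e
    using linear_scale[OF linear_D_transition] assms by (auto simp: chart_vec_def fun_eq_iff)
qed

lemma subspace_tangent:
  assumes "\<kappa> \<in> A" "p \<in> fst \<kappa>"
  shows "subspace (tangent_space A p)"
proof -
  have "range (chart_vec A \<kappa> p) = tangent_space A p"
    using chart_vec_tangent[OF assms] chart_vec_component[OF assms] by (auto simp: image_iff) metis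
  then show ?thesis
    using linear_subspace_image[OF linear_chart_vec[OF assms] subspace_UNIV] by simp
qed

lemma inj_chart_vec: "\<kappa> \<in> A \<Longrightarrow> p \<in> fst \<kappa> \<Longrightarrow> inj (chart_vec A \<kappa> p)"
  by (metis chart_vec_self injI)

lemma tangent_expansion:
  assumes "\<kappa> \<in> A" "p \<in> fst \<kappa>" "v \<in> tangent_space A p"
  shows "v = (\<Sum>b\<in>Basis. (v \<kappa> \<bullet> b) *\<^sub>R chart_vec A \<kappa> p b)"
proof -
  have "v = chart_vec A \<kappa> p (\<Sum>b\<in>Basis. (v \<kappa> \<bullet> b) *\<^sub>R b)"
    using assms by (simp add: euclidean_representation chart_vec_component)
  also have "\<dots> = (\<Sum>b\<in>Basis. (v \<kappa> \<bullet> b) *\<^sub>R chart_vec A \<kappa> p b)"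
    using linear_chart_vec[OF assms(1,2)] by (simp add: linear_sum linear_scale)
  finally show ?thesis .
qed

lemma linear_component: "linear (\<lambda>v. v \<kappa>)"
  by (rule linearI) simp_all


lemma component_cong:
  assumes "\<kappa> \<in> A" "p \<in> fst \<kappa>" "u \<in> tangent_space A p" "v \<in> tangent_space A p" "u \<kappa> = v \<kappa>"
  shows "u = v"
  by (metis assms chart_vec_component)

text \<open>
  The tangent space sits in a function space of possibly infinite dimension, but a chart transports
  its subspaces to the Euclidean model space, where dimensions can be counted.
\<close>

lemma dim_component_image:
  assumes "\<kappa> \<in> A" "p \<in> fst \<kappa>" "S \<subseteq> tangent_space A p"
  shows "dim ((\<lambda>v. v \<kappa>) ` S) = dim S"
proof -
  have "chart_vec A \<kappa> p ` ((\<lambda>v. v \<kappa>) ` S) = S"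
    using assms by (simp add: image_image chart_vec_component subset_iff cong: image_cong_simp)
  then show ?thesis
    using dim_image_eq[OF linear_chart_vec[OF assms(1,2)], of "(\<lambda>v. v \<kappa>) ` S"]
      inj_on_subset[OF inj_chart_vec[OF assms(1,2)] subset_UNIV] by metis
qed

lemma dim_direct_sum3_tangent:
  assumes "p \<in> topspace M" and sum: "direct_sum3 (tangent_space A p) U V W"
  shows "dim U + dim V + dim W = DIM('e)"
proof -
  obtain \<kappa> where \<kappa>: "\<kappa> \<in> A" "p \<in> fst \<kappa>"
    using chart_around[OF assms(1)] by blast
  let ?ev = "\<lambda>v::('a, 'e) tvec. v \<kappa>"
  note sub = sum[unfolded direct_sum3_def]
  have "direct_sum3 UNIV (?ev ` U) (?ev ` V) (?ev ` W)"
  proof (rule direct_sum3I)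
    fix e
    obtain u v w where uvw: "u \<in> U" "v \<in> V" "w \<in> W" "chart_vec A \<kappa> p e = u + v + w"
      using sub chart_vec_tangent[OF \<kappa>, of e] by blast
    then have "e = u \<kappa> + v \<kappa> + w \<kappa>"
      using chart_vec_self[OF \<kappa>, of e] by simp
    with uvw show "\<exists>u\<in>?ev ` U. \<exists>v\<in>?ev ` V. \<exists>w\<in>?ev ` W. e = u + v + w" by blast
  next
    fix a b c assume "a \<in> ?ev ` U" "b \<in> ?ev ` V" "c \<in> ?ev ` W" and 0: "a + b + c = 0"
    then obtain u v w where uvw: "u \<in> U" "v \<in> V" "w \<in> W" "a = u \<kappa>" "b = v \<kappa>" "c = w \<kappa>"
      by blast
    have "u + v + w = 0"
      using uvw sub 0 subspace_tangent[OF \<kappa>]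
      by (intro component_cong[OF \<kappa>]) (auto intro!: subspace_add subspace_0)
    then have "u = 0 \<and> v = 0 \<and> w = 0"
      by (intro direct_sum3_zeroD[OF sum uvw(1-3)])
    then show "a = 0 \<and> b = 0 \<and> c = 0" using uvw by simp
  qed (use sub linear_subspace_image[OF linear_component] in auto)
  then show ?thesis
    using sub by (simp add: dim_component_image[OF \<kappa>] dim_direct_sum3_UNIV[symmetric])
qed


section \<open>Smooth fields and distributions\<close>

lemma smooth_vector_field_onD:
  "smooth_vector_field_on A V X \<Longrightarrow> p \<in> V \<Longrightarrow> X p \<in> tangent_space A p"
  by (simp add: smooth_vector_field_on_def)

lemma smooth_tensor11D:
  assumes "smooth_tensor11 M A \<phi>" "p \<in> topspace M"
  shows "linear_on (tangent_space A p) (\<phi> p)"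
    and "v \<in> tangent_space A p \<Longrightarrow> \<phi> p v \<in> tangent_space A p"
  using assms by (simp_all add: smooth_tensor11_def image_subset_iff)

lemma smooth_vector_field_on_cong:
  assumes "openin M V" "\<And>p. p \<in> V \<Longrightarrow> X p = Y p"
  shows "smooth_vector_field_on A V X \<longleftrightarrow> smooth_vector_field_on A V Y"
proof -
  have "smooth_on (snd \<kappa> ` (fst \<kappa> \<inter> V)) (\<lambda>x. X (chart_inv \<kappa> x) \<kappa>) \<longleftrightarrow>
      smooth_on (snd \<kappa> ` (fst \<kappa> \<inter> V)) (\<lambda>x. Y (chart_inv \<kappa> x) \<kappa>)" if "\<kappa> \<in> A" for \<kappa>
    using that assms by (intro smooth_on_cong open_chart_image_Int) auto
  then show ?thesis
    using assms(2) by (simp add: smooth_vector_field_on_def)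
qed

lemma smooth_vector_field_on_subset:
  "smooth_vector_field_on A V X \<Longrightarrow> W \<subseteq> V \<Longrightarrow> smooth_vector_field_on A W X"
  unfolding smooth_vector_field_on_def by (blast intro: smooth_on_subset)

lemma subspace_tangent_topspace: "p \<in> topspace M \<Longrightarrow> subspace (tangent_space A p)"
  using chart_around subspace_tangent by blast

lemma smooth_vector_field_on_add:
  assumes "openin M V" "smooth_vector_field_on A V X" "smooth_vector_field_on A V Y"
  shows "smooth_vector_field_on A V (\<lambda>p. X p + Y p)"
  using assms openin_subset[OF assms(1)]
  by (auto simp: smooth_vector_field_on_def
      intro!: smooth_on_add open_chart_image_Int subspace_add subspace_tangent_topspace)

lemma smooth_vector_field_on_scaleR:
  assumes "openin M V" "smooth_vector_field_on A V X"
  shows "smooth_vector_field_on A V (\<lambda>p. c *\<^sub>R X p)"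
  using assms openin_subset[OF assms(1)]
  by (auto simp: smooth_vector_field_on_def
      intro!: smooth_on_scaleR smooth_on_const open_chart_image_Int subspace_scale
        subspace_tangent_topspace)

text \<open>
  In another chart \<open>\<kappa>'\<close> the components of a coordinate field are derivatives of the transition map
  from \<open>\<kappa>\<close>, but as functions of the \<open>\<kappa>'\<close>-coordinates; their smoothness is that of a composition
  with the transition map from \<open>\<kappa>'\<close> to \<open>\<kappa>\<close>.
\<close>

lemma smooth_chart_vec:
  assumes "\<kappa> \<in> A"
  shows "smooth_vector_field_on A (fst \<kappa>) (\<lambda>q. chart_vec A \<kappa> q e)"
  unfolding smooth_vector_field_on_def
proof (intro conjI ballI)
  fix \<kappa>' assume \<kappa>': "\<kappa>' \<in> A"
  let ?S = "snd \<kappa>' ` (fst \<kappa>' \<inter> fst \<kappa>)" and ?T = "snd \<kappa> ` (fst \<kappa> \<inter> fst \<kappa>')"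
  have "open ?S" "open ?T"
    using assms \<kappa>' by (auto intro!: open_chart_image_Int openin_chart)
  then have "smooth_on ?S (\<lambda>x. frechet_derivative (transition \<kappa> \<kappa>') (at (transition \<kappa>' \<kappa> x)) e)"
  proof (rule smooth_on_compose[where g = "transition \<kappa>' \<kappa>"
        and f = "\<lambda>y. frechet_derivative (transition \<kappa> \<kappa>') (at y) e"])
    show "transition \<kappa>' \<kappa> ` ?S \<subseteq> ?T"
      using \<kappa>' by (auto simp: transition_chart)
  qed (intro smooth_on_frechet_derivative smooth_transition assms \<kappa>')+
  moreover have "chart_vec A \<kappa> (chart_inv \<kappa>' x) e \<kappa>' =
      frechet_derivative (transition \<kappa> \<kappa>') (at (transition \<kappa>' \<kappa> x)) e" if "x \<in> ?S" for x
    using that \<kappa>' by (auto simp: transition_chart chart_vec_def)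
  ultimately show "smooth_on ?S (\<lambda>x. chart_vec A \<kappa> (chart_inv \<kappa>' x) e \<kappa>')"
    using smooth_on_cong[OF \<open>open ?S\<close>] by (metis (no_types, lifting))
qed (simp add: chart_vec_tangent[OF assms])

text \<open>
  In a chart, \<open>X = \<Sum>\<^sub>b X\<^sub>b E\<^sub>b\<close> with smooth coefficients \<open>X\<^sub>b\<close> and the coordinate fields \<open>E\<^sub>b\<close>. By
  linearity \<open>\<phi> X = \<Sum>\<^sub>b X\<^sub>b (\<phi> E\<^sub>b)\<close>, and the components of \<open>\<phi> E\<^sub>b\<close> in that chart are smooth by the
  definition of a smooth tensor field.
\<close>

lemma smooth_tensor11_apply:
  assumes \<phi>: "smooth_tensor11 M A \<phi>" and V: "openin M V" and X: "smooth_vector_field_on A V X"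
  shows "smooth_vector_field_on A V (\<lambda>p. \<phi> p (X p))"
  unfolding smooth_vector_field_on_def
proof (intro conjI ballI)
  fix p assume "p \<in> V"
  then show "\<phi> p (X p) \<in> tangent_space A p"
    using openin_subset[OF V] smooth_tensor11D(2)[OF \<phi>] smooth_vector_field_onD[OF X] by blast
next
  fix \<kappa> assume \<kappa>: "\<kappa> \<in> A"
  let ?S = "snd \<kappa> ` (fst \<kappa> \<inter> V)" and ?q = "chart_inv \<kappa>"
  let ?c = "\<lambda>b x. X (?q x) \<kappa> \<bullet> b" and ?E = "\<lambda>b x. chart_vec A \<kappa> (?q x) b"
  have S: "open ?S" using open_chart_image_Int[OF \<kappa> V] .
  have "smooth_on ?S (\<lambda>x. \<Sum>b\<in>Basis. ?c b x *\<^sub>R \<phi> (?q x) (?E b x) \<kappa>)"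
  proof (intro smooth_on_sum smooth_on_scaleR S)
    fix b :: 'e
    have "smooth_on ?S (\<lambda>x. X (?q x) \<kappa>)"
      using X \<kappa> by (simp add: smooth_vector_field_on_def)
    then show "smooth_on ?S (?c b)"
      by (rule smooth_on_bounded_linear[OF S bounded_linear_inner_left])
    have "smooth_on (snd \<kappa> ` fst \<kappa>) (\<lambda>x. \<phi> (?q x) (?E b x) \<kappa>)"
      using \<phi> \<kappa> by (simp add: smooth_tensor11_def)
    then show "smooth_on ?S (\<lambda>x. \<phi> (?q x) (?E b x) \<kappa>)"
      by (rule smooth_on_subset) auto
  qed
  moreover have "\<phi> (?q x) (X (?q x)) \<kappa> = (\<Sum>b\<in>Basis. ?c b x *\<^sub>R \<phi> (?q x) (?E b x) \<kappa>)"
    if "x \<in> ?S" for x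
  proof -
    from that obtain q where q: "q \<in> fst \<kappa>" "q \<in> V" "x = snd \<kappa> q" by blast
    then have qx: "?q x = q" using \<kappa> by simp
    have lin: "linear_on (tangent_space A q) (\<phi> q)"
      using smooth_tensor11D(1)[OF \<phi>] q(2) openin_subset[OF V] by blast
    have Xq: "X q \<in> tangent_space A q"
      using smooth_vector_field_onD[OF X q(2)] .
    have E: "chart_vec A \<kappa> q b \<in> tangent_space A q" for b
      by (rule chart_vec_tangent[OF \<kappa> q(1)])
    have "\<phi> q (X q) = \<phi> q (\<Sum>b\<in>Basis. (X q \<kappa> \<bullet> b) *\<^sub>R chart_vec A \<kappa> q b)"
      using tangent_expansion[OF \<kappa> q(1) Xq] by (rule arg_cong)
    also have "\<dots> = (\<Sum>b\<in>Basis. (X q \<kappa> \<bullet> b) *\<^sub>R \<phi> q (chart_vec A \<kappa> q b))"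
      by (subst linear_on_sum[OF lin subspace_tangent[OF \<kappa> q(1)]])
        (simp_all add: linear_on_scale[OF lin E] subspace_scale[OF subspace_tangent[OF \<kappa> q(1)] E])
    finally have "\<phi> q (X q) \<kappa> = (\<Sum>b\<in>Basis. (X q \<kappa> \<bullet> b) *\<^sub>R \<phi> q (chart_vec A \<kappa> q b)) \<kappa>"
      by simp
    then show ?thesis
      unfolding qx linear_sum[OF linear_component] by simp
  qed
  ultimately show "smooth_on ?S (\<lambda>x. \<phi> (?q x) (X (?q x)) \<kappa>)"
    using smooth_on_cong[OF S] by (metis (no_types, lifting))
qed

text \<open>
  The image of a smooth projection \<open>P\<close> of constant rank is a distribution. A basis of the fibre at
  \<open>p\<close> is extended to fields with constant components in a chart, and these are projected by \<open>P\<close>.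
  The projected fields agree with the basis at \<open>p\<close>, so they stay independent near \<open>p\<close>, and by
  their number they span the fibres there.
\<close>

lemma distribution_of_rank_projection:
  assumes D: "\<And>p. p \<in> topspace M \<Longrightarrow> D p \<subseteq> tangent_space A p"
      "\<And>p. p \<in> topspace M \<Longrightarrow> subspace (D p)" "\<And>p. p \<in> topspace M \<Longrightarrow> dim (D p) = k"
    and maps: "\<And>p v. p \<in> topspace M \<Longrightarrow> v \<in> tangent_space A p \<Longrightarrow> P p v \<in> D p"
    and fixes_D: "\<And>p v. p \<in> topspace M \<Longrightarrow> v \<in> D p \<Longrightarrow> P p v = v"
    and smooth: "\<And>V X. openin M V \<Longrightarrow> smooth_vector_field_on A V X \<Longrightarrow>
      smooth_vector_field_on A V (\<lambda>p. P p (X p))"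
  shows "distribution_of_rank M A k D"
  unfolding distribution_of_rank_def
proof (intro ballI conjI D)
  fix p assume p: "p \<in> topspace M"
  then obtain \<kappa> where \<kappa>: "\<kappa> \<in> A" "p \<in> fst \<kappa>"
    using chart_around by blast
  define C where "C q = (\<lambda>v. v \<kappa>) ` D q" for q
  have top: "q \<in> topspace M" if "q \<in> fst \<kappa>" for q
    using that openin_subset[OF openin_chart[OF \<kappa>(1)]] by blast
  have dim_C: "dim (C q) = k" if "q \<in> fst \<kappa>" for q
    using that D top by (simp add: C_def dim_component_image[OF \<kappa>(1)])
  obtain B where B: "B \<subseteq> C p" "independent B" "card B = k"
    using basis_exists[of "C p"] dim_C[OF \<kappa>(2)] by metis
  obtain b where b: "bij_betw b {..<k} B"
    using ex_bij_betw_nat_finite[OF independent_imp_finite[OF B(2)]] B(3)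
    by (metis atLeast0LessThan)
  define X where "X i q = P q (chart_vec A \<kappa> q (b i))" for i q
  define y where "y i x = X i (chart_inv \<kappa> x) \<kappa>" for i x
  have X: "smooth_vector_field_on A (fst \<kappa>) (X i)" for i
    unfolding X_def by (intro smooth openin_chart smooth_chart_vec \<kappa>)
  have "X i p \<kappa> = b i" if i: "i < k" for i
  proof -
    have "b i \<in> C p" using bij_betwE[OF b] B(1) i by blast
    then obtain v where v: "v \<in> D p" "b i = v \<kappa>" unfolding C_def by blast
    then have "chart_vec A \<kappa> p (b i) = v"
      using chart_vec_component[OF \<kappa>] D(1)[OF p] by auto
    with v fixes_D[OF p] show ?thesis by (simp add: X_def)
  qed
  moreover have "(y i \<longlongrightarrow> y i (snd \<kappa> p)) (nhds (snd \<kappa> p))" for i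
  proof -
    have "smooth_on (snd \<kappa> ` fst \<kappa>) (y i)"
      using X[of i] \<kappa>(1) unfolding smooth_vector_field_on_def y_def by (metis Int_absorb)
    then have "continuous (at (snd \<kappa> p)) (y i)"
      using smooth_on_imp_continuous_on open_chart_image[OF \<kappa>(1)] \<kappa>(2)
      by (metis continuous_on_eq_continuous_at imageI)
    then show ?thesis
      by (simp add: continuous_at tendsto_at_iff_tendsto_nhds)
  qed
  ultimately have "(y i \<longlongrightarrow> b i) (nhds (snd \<kappa> p))" if "i \<in> {..<k}" for i
    using that \<kappa> by (metis chart_inv_chart lessThan_iff y_def)
  then have "eventually (\<lambda>x. inj_on (\<lambda>i. y i x) {..<k} \<and> independent ((\<lambda>i. y i x) ` {..<k}))
      (nhds (snd \<kappa> p))"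
    using b B(2) by (intro eventually_independent_family[of _ _ b]) (auto simp: bij_betw_def)
  then obtain W where W: "open W" "snd \<kappa> p \<in> W"
    "\<And>x. x \<in> W \<Longrightarrow> inj_on (\<lambda>i. y i x) {..<k} \<and> independent ((\<lambda>i. y i x) ` {..<k})"
    unfolding eventually_nhds by blast
  let ?V = "{q \<in> fst \<kappa>. snd \<kappa> q \<in> W}"
  have "D q = span ((\<lambda>i. X i q) ` {..<k})" if "q \<in> ?V" for q
  proof
    have q: "q \<in> fst \<kappa>" "snd \<kappa> q \<in> W" using that by auto
    have X_D: "X i q \<in> D q" for i
      unfolding X_def by (intro maps top q chart_vec_tangent \<kappa>)
    then show "span ((\<lambda>i. X i q) ` {..<k}) \<subseteq> D q"
      using D(2)[OF top[OF q(1)]] by (intro span_minimal) auto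
    have y: "y i (snd \<kappa> q) = X i q \<kappa>" for i
      using \<kappa>(1) q(1) by (simp add: y_def)
    have "C q \<subseteq> span ((\<lambda>i. X i q \<kappa>) ` {..<k})"
      using W(3)[OF q(2)] X_D dim_C[OF q(1)] unfolding y
      by (intro card_ge_dim_independent) (auto simp: C_def card_image)
    then have "chart_vec A \<kappa> q ` C q \<subseteq> span (chart_vec A \<kappa> q ` (\<lambda>i. X i q \<kappa>) ` {..<k})"
      using linear_span_image[OF linear_chart_vec[OF \<kappa>(1) q(1)]] by blast
    moreover have "chart_vec A \<kappa> q (v \<kappa>) = v" if "v \<in> D q" for v
      using chart_vec_component[OF \<kappa>(1) q(1)] D(1)[OF top[OF q(1)]] that by blast
    ultimately show "D q \<subseteq> span ((\<lambda>i. X i q) ` {..<k})"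
      using X_D by (simp add: C_def image_image)
  qed
  moreover have "smooth_vector_field_on A ?V (X i)" for i
    by (rule smooth_vector_field_on_subset[OF X]) auto
  ultimately show "\<exists>V X. openin M V \<and> p \<in> V \<and> (\<forall>i<k. smooth_vector_field_on A V (X i)) \<and>
      (\<forall>q\<in>V. D q = span ((\<lambda>i. X i q) ` {..<k}))"
    using openin_chart_vimage[OF \<kappa>(1) W(1)] \<kappa>(2) W(2)
    by (intro exI[of _ ?V] exI[of _ X]) simp
qed

end


section \<open>Almost bi-paracontact manifolds\<close>

lemma distribution_of_rank_cong:
  assumes D: "distribution_of_rank M A k D" and eq: "\<And>p. p \<in> topspace M \<Longrightarrow> E p = D p"
  shows "distribution_of_rank M A k E"
  unfolding distribution_of_rank_def
proof (intro ballI)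
  fix p assume p: "p \<in> topspace M"
  from D p have *: "D p \<subseteq> tangent_space A p" "subspace (D p)" "dim (D p) = k"
    "\<exists>V X. openin M V \<and> p \<in> V \<and> (\<forall>i<k. smooth_vector_field_on A V (X i)) \<and>
      (\<forall>q\<in>V. D q = span ((\<lambda>i. X i q) ` {..<k}))"
    unfolding distribution_of_rank_def by simp_all
  from *(4) obtain V X where V: "openin M V" "p \<in> V" "\<forall>i<k. smooth_vector_field_on A V (X i)"
    "\<forall>q\<in>V. D q = span ((\<lambda>i. X i q) ` {..<k})"
    by (elim exE conjE)
  then have "\<forall>q\<in>V. E q = span ((\<lambda>i. X i q) ` {..<k})"
    using eq openin_subset[OF V(1)] by (simp add: subset_iff)
  with V * show "E p \<subseteq> tangent_space A p \<and> subspace (E p) \<and> dim (E p) = k \<and>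
      (\<exists>V X. openin M V \<and> p \<in> V \<and> (\<forall>i<k. smooth_vector_field_on A V (X i)) \<and>
        (\<forall>q\<in>V. E q = span ((\<lambda>i. X i q) ` {..<k})))"
    unfolding eq[OF p] by (intro conjI exI[of _ V] exI[of _ X])
qed

lemma eigendistribution_eq_eigenspace:
  "eigendistribution A \<phi> c p = eigenspace (tangent_space A p) (\<phi> p) c"
  by (simp add: eigendistribution_def eigenspace_def)

locale almost_bi_paracontact_manifold =
  fixes n :: nat
    and M :: "'a topology"
    and A :: "('a, 'e::euclidean_space) chart set"
    and \<eta> :: "'a \<Rightarrow> ('a, 'e) tvec \<Rightarrow> real"
    and \<xi> :: "'a \<Rightarrow> ('a, 'e) tvec"
    and \<phi> :: "nat \<Rightarrow> 'a \<Rightarrow> ('a, 'e) tvec \<Rightarrow> ('a, 'e) tvec"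
  assumes bi_paracontact: "almost_bi_paracontact n M A \<eta> \<xi> \<phi>"
begin

sublocale smooth_atlas M A
  using bi_paracontact
  by unfold_locales (simp add: almost_bi_paracontact_def contact_manifold_def)

lemma
  shows DIM_eq: "DIM('e) = 2 * n + 1"
    and smooth_\<eta>: "smooth_one_form M A \<eta>"
    and smooth_\<xi>: "smooth_vector_field_on A (topspace M) \<xi>"
    and smooth_\<phi>: "i \<in> {1, 2, 3} \<Longrightarrow> smooth_tensor11 M A (\<phi> i)"
  using bi_paracontact
  unfolding almost_bi_paracontact_def contact_manifold_def is_reeb_field_def by blast+

lemma anticommuting_pair:
  assumes "\<alpha> \<in> {1, 2}" "\<beta> \<in> {1, 2}" "\<alpha> \<noteq> \<beta>" "p \<in> topspace M"
  shows "anticommuting_paracontact_pair (tangent_space A p) (\<phi> \<alpha> p) (\<phi> \<beta> p) (\<eta> p) (\<xi> p)"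
proof -
  let ?T = "tangent_space A p"
  have relations: "\<phi> 1 p (\<phi> 2 p v) = - \<phi> 2 p (\<phi> 1 p v)"
      "\<phi> 1 p (\<phi> 1 p v) = v - \<eta> p v *\<^sub>R \<xi> p" "\<phi> 2 p (\<phi> 2 p v) = v - \<eta> p v *\<^sub>R \<xi> p"
    if "v \<in> ?T" for v
    using bi_paracontact assms(4) that unfolding almost_bi_paracontact_def by blast+
  have endo: "linear_on ?T (\<phi> i p)" "v \<in> ?T \<Longrightarrow> \<phi> i p v \<in> ?T" if "i \<in> {1, 2}" for i v
    using smooth_tensor11D[OF smooth_\<phi>[of i] assms(4)] that by auto
  have reeb: "linear_on ?T (\<eta> p)" "\<xi> p \<in> ?T" "\<eta> p (\<xi> p) = 1"
    using bi_paracontact smooth_\<eta> smooth_\<xi> assms(4)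
    unfolding smooth_one_form_def smooth_vector_field_on_def almost_bi_paracontact_def
      is_reeb_field_def by blast+
  have "anticommuting_paracontact_pair ?T (\<phi> 1 p) (\<phi> 2 p) (\<eta> p) (\<xi> p)"
    by unfold_locales
      (simp_all add: relations endo reeb subspace_tangent_topspace assms(4) del: One_nat_def)
  then show ?thesis
    using assms(1-3) anticommuting_paracontact_pair.swap by auto
qed

lemma other_index: "\<alpha> \<in> {1, 2} \<Longrightarrow> \<exists>\<beta>\<in>{1, 2}. \<alpha> \<noteq> (\<beta> :: nat)"
  by auto

lemma paracontact_endomorphism:
  assumes "\<alpha> \<in> {1, 2}" "p \<in> topspace M"
  shows "paracontact_endomorphism (tangent_space A p) (\<phi> \<alpha> p) (\<eta> p) (\<xi> p)"
  using other_index[OF assms(1)] anticommuting_pair[OF assms(1) _ _ assms(2)]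
    anticommuting_paracontact_pair.axioms(1) by blast

lemma direct_sum_eigendistributions:
  assumes "\<alpha> \<in> {1, 2}" "p \<in> topspace M"
  shows "direct_sum3 (tangent_space A p)
    (eigendistribution A (\<phi> \<alpha>) 1 p) (eigendistribution A (\<phi> \<alpha>) (-1) p) (span {\<xi> p})"
  unfolding eigendistribution_eq_eigenspace
  by (rule paracontact_endomorphism.direct_sum3_eigenspaces[OF paracontact_endomorphism[OF assms]])

lemma direct_sum_mixed_eigendistributions:
  assumes "\<alpha> \<in> {1, 2}" "\<beta> \<in> {1, 2}" "\<alpha> \<noteq> \<beta>" "p \<in> topspace M" "s \<in> {1, -1}" "t \<in> {1, -1}"
  shows "direct_sum3 (tangent_space A p)
    (eigendistribution A (\<phi> \<alpha>) s p) (eigendistribution A (\<phi> \<beta>) t p) (span {\<xi> p})"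
  unfolding eigendistribution_eq_eigenspace
  by (rule anticommuting_paracontact_pair.direct_sum3_mixed_eigenspaces
      [OF anticommuting_pair[OF assms(1-4)] assms(5,6)])

lemma image_eigendistribution:
  assumes "\<alpha> \<in> {1, 2}" "\<beta> \<in> {1, 2}" "\<alpha> \<noteq> \<beta>" "p \<in> topspace M" "c \<noteq> 0"
  shows "\<phi> \<alpha> p ` eigendistribution A (\<phi> \<beta>) c p = eigendistribution A (\<phi> \<beta>) (- c) p"
  unfolding eigendistribution_eq_eigenspace
  by (rule anticommuting_paracontact_pair.image_eigenspace
      [OF anticommuting_pair[OF assms(1-4)] assms(5)])

lemma image_eigendistribution_self:
  assumes "\<alpha> \<in> {1, 2}" "p \<in> topspace M" "c \<noteq> 0"
  shows "\<phi> \<alpha> p ` eigendistribution A (\<phi> \<alpha>) c p = eigendistribution A (\<phi> \<alpha>) c p"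
  unfolding eigendistribution_eq_eigenspace
  by (rule paracontact_endomorphism.image_eigenspace_self
      [OF paracontact_endomorphism[OF assms(1,2)] assms(3)])

lemma image_eigendistribution_3:
  assumes "\<alpha> \<in> {1, 2}" "p \<in> topspace M" "c \<noteq> 0"
  shows "\<phi> 3 p ` eigendistribution A (\<phi> \<alpha>) c p = eigendistribution A (\<phi> \<alpha>) (- c) p"
proof -
  have "\<phi> 3 p v = \<phi> 1 p (\<phi> 2 p v)" if "v \<in> tangent_space A p" for v
    using bi_paracontact assms(2) that unfolding almost_bi_paracontact_def by blast
  then have "\<phi> 3 p ` eigendistribution A (\<phi> \<alpha>) c p =
      \<phi> 1 p ` \<phi> 2 p ` eigendistribution A (\<phi> \<alpha>) c p"
    unfolding image_image by (intro image_cong) (auto simp: eigendistribution_def)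
  also have "\<dots> = eigendistribution A (\<phi> \<alpha>) (- c) p"
    using assms(1)
  proof (elim insertE emptyE)
    assume "\<alpha> = 1"
    then show ?thesis
      using image_eigendistribution[of 2 1 p c] image_eigendistribution_self[of 1 p "- c"] assms
      by (simp del: One_nat_def)
  next
    assume "\<alpha> = 2"
    then show ?thesis
      using image_eigendistribution[of 1 2 p c] image_eigendistribution_self[of 2 p c] assms
      by (simp del: One_nat_def)
  qed
  finally show ?thesis .
qed

text \<open>
  With \<open>\<beta> \<noteq> \<alpha>\<close>, the direct sums \<open>D\<^sub>\<alpha>\<^sup>+ \<oplus> D\<^sub>\<alpha>\<^sup>-\<close>, \<open>D\<^sub>\<alpha>\<^sup>+ \<oplus> D\<^sub>\<beta>\<^sup>+\<close> and \<open>D\<^sub>\<alpha>\<^sup>- \<oplus> D\<^sub>\<beta>\<^sup>+\<close> all have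
  dimension \<open>2n\<close>.
\<close>

lemma dim_eigendistribution:
  assumes "\<alpha> \<in> {1, 2}" "s \<in> {1, -1}" "p \<in> topspace M"
  shows "dim (eigendistribution A (\<phi> \<alpha>) s p) = n"
proof -
  obtain \<beta> where \<beta>: "\<beta> \<in> {1, 2}" "\<alpha> \<noteq> \<beta>"
    using other_index[OF assms(1)] by blast
  interpret paracontact_endomorphism "tangent_space A p" "\<phi> \<alpha> p" "\<eta> p" "\<xi> p"
    by (rule paracontact_endomorphism[OF assms(1,3)])
  have "\<xi> p \<noteq> 0"
    using form_vector h_scale[OF vector, of 0] by auto
  then have "dim (span {\<xi> p}) = 1"
    using dim_span_eq_card_independent[of "{\<xi> p}"] by simp
  then have "dim (eigendistribution A (\<phi> \<alpha>) 1 p) + dim (eigendistribution A (\<phi> \<alpha>) (-1) p) = 2 * n"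
    "dim (eigendistribution A (\<phi> \<alpha>) 1 p) + dim (eigendistribution A (\<phi> \<beta>) 1 p) = 2 * n"
    "dim (eigendistribution A (\<phi> \<alpha>) (-1) p) + dim (eigendistribution A (\<phi> \<beta>) 1 p) = 2 * n"
    using dim_direct_sum3_tangent[OF assms(3) direct_sum_eigendistributions[OF assms(1,3)]]
      dim_direct_sum3_tangent[OF assms(3)
        direct_sum_mixed_eigendistributions[OF assms(1) \<beta> assms(3), of 1 1]]
      dim_direct_sum3_tangent[OF assms(3)
        direct_sum_mixed_eigendistributions[OF assms(1) \<beta> assms(3), of "-1" 1]]
    by (simp_all add: DIM_eq)
  then show ?thesis using assms(2) by auto
qed

lemma distribution_of_rank_eigendistribution:
  assumes \<alpha>: "\<alpha> \<in> {1, 2}" and s: "s \<in> {1, -1}"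
  shows "distribution_of_rank M A n (eigendistribution A (\<phi> \<alpha>) s)"
proof (rule distribution_of_rank_projection)
  note endo = paracontact_endomorphism[OF \<alpha>]
  let ?P = "\<lambda>p. eigenprojection (\<phi> \<alpha> p) s"
  fix p assume p: "p \<in> topspace M"
  show "eigendistribution A (\<phi> \<alpha>) s p \<subseteq> tangent_space A p"
    by (auto simp: eigendistribution_def)
  show "subspace (eigendistribution A (\<phi> \<alpha>) s p)"
    unfolding eigendistribution_eq_eigenspace
    by (rule paracontact_endomorphism.subspace_eigenspace[OF endo[OF p]])
  show "dim (eigendistribution A (\<phi> \<alpha>) s p) = n"
    by (rule dim_eigendistribution[OF \<alpha> s p])
  show "?P p v \<in> eigendistribution A (\<phi> \<alpha>) s p" if "v \<in> tangent_space A p" for v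
    unfolding eigendistribution_eq_eigenspace
    by (rule paracontact_endomorphism.eigenprojection_eigenspace[OF endo[OF p] s that])
  show "?P p v = v" if "v \<in> eigendistribution A (\<phi> \<alpha>) s p" for v
    using that unfolding eigendistribution_eq_eigenspace
    by (rule paracontact_endomorphism.eigenprojection_fixes[OF endo[OF p] s])
next
  fix V X assume V: "openin M V" and X: "smooth_vector_field_on A V X"
  have \<phi>: "smooth_tensor11 M A (\<phi> \<alpha>)" using smooth_\<phi> \<alpha> by blast
  note \<phi>X = smooth_tensor11_apply[OF \<phi> V]
  show "smooth_vector_field_on A V (\<lambda>p. eigenprojection (\<phi> \<alpha> p) s (X p))"
    unfolding eigenprojection_def
    by (intro smooth_vector_field_on_scaleR smooth_vector_field_on_add V \<phi>X X)
qed

text \<open>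
  Sections of the eigendistributions take values in the kernel of \<open>\<eta>\<close>, where \<open>\<phi>\<^sub>\<alpha>\<close> is an involution:
  applying the smooth \<open>\<phi>\<^sub>\<alpha>\<close> once more recovers the original section.
\<close>

lemma distribution_isomorphism_eigendistributions:
  assumes \<alpha>\<beta>: "\<alpha> \<in> {1, 2}" "\<beta> \<in> {1, 2}" "\<alpha> \<noteq> \<beta>" and "c \<noteq> 0"
  shows "distribution_isomorphism M A
    (eigendistribution A (\<phi> \<beta>) c) (eigendistribution A (\<phi> \<beta>) (- c)) (\<phi> \<alpha>)"
  unfolding distribution_isomorphism_def
proof (intro conjI ballI allI impI)
  note pair = anticommuting_pair[OF \<alpha>\<beta>]
  have \<phi>: "smooth_tensor11 M A (\<phi> \<alpha>)" using smooth_\<phi> \<alpha>\<beta>(1) by blast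
  {
    fix p assume p: "p \<in> topspace M"
    show "linear_on (eigendistribution A (\<phi> \<beta>) c p) (\<phi> \<alpha> p)"
      by (rule linear_on_subset[OF smooth_tensor11D(1)[OF \<phi> p]])
        (auto simp: eigendistribution_def)
    show "bij_betw (\<phi> \<alpha> p) (eigendistribution A (\<phi> \<beta>) c p) (eigendistribution A (\<phi> \<beta>) (- c) p)"
      unfolding eigendistribution_eq_eigenspace
      by (rule anticommuting_paracontact_pair.bij_betw_eigenspaces[OF pair[OF p] \<open>c \<noteq> 0\<close>])
  }
  fix V X assume VX: "openin M V \<and> (\<forall>p\<in>V. X p \<in> eigendistribution A (\<phi> \<beta>) c p)"
  then have V: "openin M V" by blast
  have "\<phi> \<alpha> p (\<phi> \<alpha> p (X p)) = X p" if "p \<in> V" for p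
  proof -
    have p: "p \<in> topspace M" using that openin_subset[OF V] by blast
    interpret anticommuting_paracontact_pair "tangent_space A p" "\<phi> \<alpha> p" "\<phi> \<beta> p" "\<eta> p" "\<xi> p"
      by (rule pair[OF p])
    have "X p \<in> eigenspace (tangent_space A p) (\<phi> \<beta> p) c"
      using VX that by (simp add: eigendistribution_eq_eigenspace)
    then show ?thesis
      using g.form_eigenspace \<open>c \<noteq> 0\<close> g.eigenspace_subset f.square_kernel by blast
  qed
  then have "smooth_vector_field_on A V (\<lambda>p. \<phi> \<alpha> p (\<phi> \<alpha> p (X p))) \<longleftrightarrow>
      smooth_vector_field_on A V X"
    by (rule smooth_vector_field_on_cong[OF V])
  then show "smooth_vector_field_on A V X \<longleftrightarrow> smooth_vector_field_on A V (\<lambda>p. \<phi> \<alpha> p (X p))"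
    using smooth_tensor11_apply[OF \<phi> V] by blast
qed

lemma almost_paracontact_\<phi>:
  assumes \<alpha>: "\<alpha> \<in> {1, 2}"
  shows "almost_paracontact n M A (\<phi> \<alpha>) \<xi> \<eta>"
proof -
  note endo = paracontact_endomorphism[OF \<alpha>]
  have "\<forall>p\<in>topspace M. \<eta> p (\<xi> p) = 1 \<and> (\<forall>v\<in>tangent_space A p. \<phi> \<alpha> p (\<phi> \<alpha> p v) = v - \<eta> p v *\<^sub>R \<xi> p) \<and>
      \<phi> \<alpha> p ` contact_distribution A \<eta> p \<subseteq> contact_distribution A \<eta> p"
  proof
    fix p assume p: "p \<in> topspace M"
    interpret paracontact_endomorphism "tangent_space A p" "\<phi> \<alpha> p" "\<eta> p" "\<xi> p"
      by (rule endo[OF p])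
    show "\<eta> p (\<xi> p) = 1 \<and> (\<forall>v\<in>tangent_space A p. \<phi> \<alpha> p (\<phi> \<alpha> p v) = v - \<eta> p v *\<^sub>R \<xi> p) \<and>
        \<phi> \<alpha> p ` contact_distribution A \<eta> p \<subseteq> contact_distribution A \<eta> p"
      by (auto simp: form_vector square contact_distribution_def maps form_f)
  qed
  moreover have "\<forall>c\<in>{1, -1}. distribution_of_rank M A n
      (\<lambda>p. eigendistribution A (\<phi> \<alpha>) c p \<inter> contact_distribution A \<eta> p)"
  proof
    fix c :: real assume c: "c \<in> {1, -1}"
    then have "c \<noteq> 0" by auto
    then have "eigendistribution A (\<phi> \<alpha>) c p \<subseteq> contact_distribution A \<eta> p"
      if "p \<in> topspace M" for p
      using paracontact_endomorphism.form_eigenspace[OF endo[OF that], of _ c]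
      by (auto simp: eigendistribution_eq_eigenspace contact_distribution_def eigenspace_def)
    then have "eigendistribution A (\<phi> \<alpha>) c p \<inter> contact_distribution A \<eta> p =
        eigendistribution A (\<phi> \<alpha>) c p" if "p \<in> topspace M" for p
      using that by (simp add: Int_absorb2)
    with distribution_of_rank_eigendistribution[OF \<alpha> c]
    show "distribution_of_rank M A n
        (\<lambda>p. eigendistribution A (\<phi> \<alpha>) c p \<inter> contact_distribution A \<eta> p)"
      by (rule distribution_of_rank_cong)
  qed
  moreover have "smooth_tensor11 M A (\<phi> \<alpha>)" using smooth_\<phi> \<alpha> by blast
  ultimately show ?thesis
    using smooth_manifold DIM_eq smooth_\<xi> smooth_\<eta> unfolding almost_paracontact_def
    by (intro conjI)
qed

end

theorem proposition3p2:
  fixes n :: nat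
    and M :: "'a topology"
    and A :: "('a, 'e::euclidean_space) chart set"
    and \<eta> :: "'a \<Rightarrow> ('a, 'e) tvec \<Rightarrow> real"
    and \<xi> :: "'a \<Rightarrow> ('a, 'e) tvec"
    and \<phi> :: "nat \<Rightarrow> 'a \<Rightarrow> ('a, 'e) tvec \<Rightarrow> ('a, 'e) tvec"
  assumes "almost_bi_paracontact n M A \<eta> \<xi> \<phi>"
  shows
    "(\<forall>p\<in>topspace M.
        \<phi> 1 p ` eigendistribution A (\<phi> 2) 1 p = eigendistribution A (\<phi> 2) (-1) p \<and>
        \<phi> 1 p ` eigendistribution A (\<phi> 2) (-1) p = eigendistribution A (\<phi> 2) 1 p) \<and>
     (\<forall>p\<in>topspace M.
        \<phi> 2 p ` eigendistribution A (\<phi> 1) 1 p = eigendistribution A (\<phi> 1) (-1) p \<and>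
        \<phi> 2 p ` eigendistribution A (\<phi> 1) (-1) p = eigendistribution A (\<phi> 1) 1 p) \<and>
     (\<forall>\<alpha>\<in>{1, 2}. \<forall>p\<in>topspace M.
        \<phi> 3 p ` eigendistribution A (\<phi> \<alpha>) 1 p = eigendistribution A (\<phi> \<alpha>) (-1) p \<and>
        \<phi> 3 p ` eigendistribution A (\<phi> \<alpha>) (-1) p = eigendistribution A (\<phi> \<alpha>) 1 p) \<and>
     (distribution_isomorphism M A
        (eigendistribution A (\<phi> 2) 1) (eigendistribution A (\<phi> 2) (-1)) (\<phi> 1) \<and>
      distribution_isomorphism M A
        (eigendistribution A (\<phi> 1) 1) (eigendistribution A (\<phi> 1) (-1)) (\<phi> 2)) \<and>
     (\<forall>\<alpha>\<in>{1, 2}. \<forall>\<beta>\<in>{1, 2}. \<alpha> \<noteq> \<beta> \<longrightarrow> (\<forall>p\<in>topspace M.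
        direct_sum3 (tangent_space A p)
          (eigendistribution A (\<phi> \<alpha>) 1 p) (eigendistribution A (\<phi> \<alpha>) (-1) p) (span {\<xi> p}) \<and>
        (\<forall>s\<in>{1, -1}. \<forall>t\<in>{1, -1}.
           direct_sum3 (tangent_space A p)
             (eigendistribution A (\<phi> \<alpha>) s p) (eigendistribution A (\<phi> \<beta>) t p) (span {\<xi> p})))) \<and>
     (\<forall>\<alpha>\<in>{1, 2}. \<forall>s\<in>{1, -1}. distribution_of_rank M A n (eigendistribution A (\<phi> \<alpha>) s)) \<and>
     (\<forall>\<alpha>\<in>{1, 2}. almost_paracontact n M A (\<phi> \<alpha>) \<xi> \<eta>)"
proof -
  interpret almost_bi_paracontact_manifold n M A \<eta> \<xi> \<phi>
    by unfold_locales (fact assms)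
  have image: "\<phi> \<alpha> p ` eigendistribution A (\<phi> \<beta>) 1 p = eigendistribution A (\<phi> \<beta>) (-1) p \<and>
      \<phi> \<alpha> p ` eigendistribution A (\<phi> \<beta>) (-1) p = eigendistribution A (\<phi> \<beta>) 1 p"
    if "\<alpha> \<in> {1, 2}" "\<beta> \<in> {1, 2}" "\<alpha> \<noteq> \<beta>" "p \<in> topspace M" for \<alpha> \<beta> p
    using image_eigendistribution[OF that, of 1] image_eigendistribution[OF that, of "-1"] by simp
  have image_3: "\<phi> 3 p ` eigendistribution A (\<phi> \<alpha>) 1 p = eigendistribution A (\<phi> \<alpha>) (-1) p \<and>
      \<phi> 3 p ` eigendistribution A (\<phi> \<alpha>) (-1) p = eigendistribution A (\<phi> \<alpha>) 1 p"
    if "\<alpha> \<in> {1, 2}" "p \<in> topspace M" for \<alpha> p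
    using image_eigendistribution_3[OF that, of 1] image_eigendistribution_3[OF that, of "-1"]
    by simp
  \<comment> \<open>The instances of \<open>conjI\<close> keep the paired equalities of \<open>image\<close> and \<open>image_3\<close> together.\<close>
  show ?thesis
    by (intro conjI[of "Ball (topspace M) _"] conjI[of "Ball {1, 2} _"]
        conjI[of "distribution_isomorphism _ _ _ _ _ \<and> _"]
        conjI[of "distribution_isomorphism _ _ _ _ _"]
        conjI[of "direct_sum3 _ _ _ _"] ballI impI image image_3
        distribution_isomorphism_eigendistributions direct_sum_eigendistributions
        direct_sum_mixed_eigendistributions distribution_of_rank_eigendistribution
        almost_paracontact_\<phi>) simp_all
qed

end
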